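(* For integers $b>1$ and $c>0$ and a positive prime $a$, the equation $$a^x - b^y = c$$ has at most two solutions in nonnegative integers $(x,y)$, except for $(a,b,c)=(2,5,3)$, which has solutions $(x,y)=(2,0)$, $(3,1)$, $(7,3)$. Moreover, there are infinitely many triples $(a,b,c)$ (with $a$ a positive prime and $b>1$, $c>0$ integers) for which the equation $a^x-b^y=c$ has two solutions in nonnegative integers $(x,y)$. *)

theory Defs
  imports "HOL-Computational_Algebra.Primes"
begin

definition solutions :: "int \<Rightarrow> int \<Rightarrow> int \<Rightarrow> (nat \<times> nat) set" where
  "solutions a b c = {(x, y). a ^ x - b ^ y = c}"

end

theory Submission
  imports Complex_Main Defs "HOL-Number_Theory.Cong"
begin

text \<open>
  Write \<open>p\<close> for the prime base. If \<open>p\<close> divides \<open>b\<close>, comparing powers of \<open>p\<close> in \<open>c = p^x - b^y\<close>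
  fixes \<open>y\<close> as soon as \<open>y > 0\<close>. So let \<open>p\<close> divide neither \<open>b\<close> nor \<open>c\<close>. Among three solutions two have exponents
  \<open>y\<close> of the same parity, and the proof is about such a pair \<open>p^u = b^y + c\<close>, \<open>p^v = b^(y+2d) + c\<close>.

  Put \<open>A = b^y\<close>. Both right-hand sides are values of the form \<open>A X^2 + c Y^2\<close>, at \<open>(1, 1)\<close> and at
  \<open>(b^d, 1)\<close>, i.e. norms of \<open>X \<surd>A + Y \<surd>(-c)\<close>. Unique factorisation of ideals would say that
  the prime ideals above \<open>p\<close> allow essentially one element of each norm. This is proved here by an elementary
  descent (lemma \<open>descent\<close>): with \<open>\<alpha> = \<surd>A + \<surd>(-c)\<close>, the smallest element of its kind,
  \<open>b^d \<surd>A \<plusminus> \<surd>(-c) = \<plusminus>\<alpha>^j\<close>, with \<open>j\<close> odd if \<open>A > 1\<close>. For \<open>p = 2\<close> all elements are halved.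

  If \<open>y > 0\<close>, the quotient of the real parts of \<open>\<alpha>^j\<close> and \<open>\<alpha>\<close> is a power of \<open>b\<close>, and every prime dividing
  \<open>b\<close> divides \<open>A\<close>. Modulo \<open>A\<close> this quotient is \<open>j\<close> times a unit, so a prime factor \<open>q\<close> of \<open>b\<close> divides
  \<open>j\<close>. Replacing \<open>\<alpha>\<close> by \<open>\<beta> = \<alpha>^(j/q)\<close>, the corresponding quotient for \<open>\<beta>^q\<close> is a power of \<open>q\<close>; except for
  \<open>q = 3\<close> it is not divisible by \<open>q^2\<close>, and then it is too small for the norm of \<open>\<beta>^q\<close>, unless
  \<open>\<beta>\<close> has norm \<open>2\<close> and \<open>q = 5\<close>. The imaginary part, which stays \<open>\<plusminus>1\<close>, settles \<open>q = 3\<close>. The outcome (lemma \<open>same_parity_solutions\<close>, for \<open>c > 1\<close>) is that \<open>y = 1\<close> and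
  \<open>(p, b, c)\<close> is one of four triples. For \<open>c = 1\<close> a similar but simpler argument with
  \<open>(P^n - 1)/(P - 1)\<close> applies (lemma \<open>consecutive_powers\<close>).

  It remains to exclude solutions with \<open>y = 0\<close>, with \<open>y > 0\<close> even and with \<open>y\<close> odd at the same time. For \<open>p = 2\<close> the
  \<open>2\<close>-adic valuations of \<open>b - 1\<close> and \<open>b^(2m) - 1\<close> clash. For \<open>p > 2\<close> the descent with \<open>A = 1\<close> gives
  \<open>b^m + \<surd>(-c) = \<plusminus>(1 + \<surd>(-c))^j\<close>; that the imaginary part is \<open>\<plusminus>1\<close> forces \<open>j \<equiv> 3\<close> modulo \<open>4\<close>, and
  the third equation fails modulo \<open>8\<close>.

  Infinitely many triples with two solutions come from
  \<open>2^(2s) - (2^s - 1)^2 = 2^(s+1) - 1 = 2^(s+1) - (2^s - 1)^0\<close>.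
\<close>

section \<open>Elements of prime power norm in an imaginary quadratic field\<close>

lemma one_le_square: "1 \<le> x\<^sup>2" if "x \<noteq> 0" for x :: int
  using that zero_less_power2[of x] by linarith

text \<open>
  The numbers \<open>(X \<surd>A + Y \<surd>(-C)) / D\<close> have norm \<open>(A X^2 + C Y^2) / D^2\<close>. Taking \<open>D = 2\<close>
  for \<open>p = 2\<close> is the passage to the order containing \<open>(1 + \<surd>(-A C)) / 2\<close>, in which \<open>2\<close> splits; \<open>E = 2 / D\<close> only serves to
  avoid fractions. The number with \<open>X = Y = 1\<close> has norm \<open>p^h\<close> by \<open>AC\<close>. The bound on \<open>C\<close> keeps \<open>\<plusminus>1\<close> the only
  units of the form considered here.
\<close>
locale norm_form =
  fixes p A C D E :: int and h :: nat
  assumes p: "prime p" and A: "1 \<le> A" and C: "2 \<le> C"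
    and pA: "\<not> p dvd A" and pC: "\<not> p dvd C"
    and DE: "p \<noteq> 2 \<and> D = 1 \<and> E = 2 \<or> p = 2 \<and> D = 2 \<and> E = 1 \<and> 2 \<le> A"
    and h: "1 \<le> h" and AC: "A + C = D\<^sup>2 * p ^ h"
begin

definition elt :: "int \<Rightarrow> int \<Rightarrow> complex" where
  "elt X Y = Complex (X * (sqrt A / D)) (Y * (sqrt C / D))"

abbreviation \<alpha> :: complex where "\<alpha> \<equiv> elt 1 1"

lemma p_gt1: "1 < p" using p prime_gt_1_int by blast

lemma D_pos: "0 < D" and ED: "D * E = 2" using DE by auto

lemma elt_neg: "elt (- X) (- Y) = - elt X Y"
  by (simp add: elt_def complex_eq_iff)

lemma elt_square_mult:
  assumes "D\<^sup>2 * X = (A - C) * X' - 2 * C * Y'" "D\<^sup>2 * Y = (A - C) * Y' + 2 * A * X'"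
  shows "elt X Y = \<alpha>\<^sup>2 * elt X' Y'"
proof -
  define a c where ac: "a = sqrt A / D" "c = sqrt C / D"
  have D: "(real_of_int D)\<^sup>2 \<noteq> 0" using D_pos by simp
  have a2: "a\<^sup>2 = A / (real_of_int D)\<^sup>2" and c2: "c\<^sup>2 = C / (real_of_int D)\<^sup>2"
    using A C by (auto simp: ac power_divide)
  have 1: "(real_of_int D)\<^sup>2 * X = (A - C) * X' - 2 * C * Y'"
    and 2: "(real_of_int D)\<^sup>2 * Y = (A - C) * Y' + 2 * A * X'"
    using assms[THEN arg_cong[of _ _ real_of_int]] by simp_all
  have X: "real_of_int X = (a\<^sup>2 - c\<^sup>2) * X' - 2 * c\<^sup>2 * Y'"
  proof -
    have "real_of_int X = ((A - C) * X' - 2 * C * Y') / (real_of_int D)\<^sup>2"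
      using 1 D by (simp add: eq_divide_eq mult.commute)
    then show ?thesis by (simp add: a2 c2 diff_divide_distrib left_diff_distrib)
  qed
  have Y: "real_of_int Y = (a\<^sup>2 - c\<^sup>2) * Y' + 2 * a\<^sup>2 * X'"
  proof -
    have "real_of_int Y = ((A - C) * Y' + 2 * A * X') / (real_of_int D)\<^sup>2"
      using 2 D by (simp add: eq_divide_eq mult.commute)
    then show ?thesis by (simp add: a2 c2 diff_divide_distrib add_divide_distrib left_diff_distrib)
  qed
  show ?thesis unfolding elt_def ac[symmetric] X Y
    by (simp add: complex_eq_iff power2_eq_square algebra_simps)
qed

text \<open>
  Subtracting \<open>Y^2\<close> times the norm equation of \<open>\<alpha>\<close> shows that \<open>D^2 p^h\<close> divides \<open>A (Y - X)(Y + X)\<close>, and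
  the two factors share no \<open>p\<close> beyond the \<open>2\<close> that \<open>D\<close> accounts for. The alternative decides which of the
  two conjugate prime ideals above \<open>p\<close> contains the element: in the first case it is divisible by \<open>\<alpha>\<close>, in the second
  by its conjugate.
\<close>
lemma prime_power_dvd_difference_or_sum:
  assumes N: "A * X\<^sup>2 + C * Y\<^sup>2 = D\<^sup>2 * p ^ n" and n: "h \<le> n" and pX: "\<not> p dvd X"
  shows "D * p ^ h dvd Y - X \<or> D * p ^ h dvd Y + X"
proof -
  have "A * ((Y - X) * (Y + X)) = (A + C) * Y\<^sup>2 - D\<^sup>2 * p ^ n"
    using N by (simp add: algebra_simps power2_eq_square)
  also have "\<dots> = D\<^sup>2 * p ^ h * (Y\<^sup>2 - p ^ (n - h))"
    using n by (simp add: AC algebra_simps flip: power_add)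
  finally have eq: "A * ((Y - X) * (Y + X)) = D\<^sup>2 * p ^ h * (Y\<^sup>2 - p ^ (n - h))" .
  have cop: "coprime (p ^ k) x" if "\<not> p dvd x" for x k
    using p that by (simp add: prime_imp_coprime)
  show ?thesis
  proof (cases "p = 2")
    case False
    then have [simp]: "D = 1" using DE by auto
    have d: "p ^ h dvd (Y - X) * (Y + X)"
      using cop[OF pA, of h] eq by (metis \<open>D = 1\<close> coprime_dvd_mult_right_iff dvd_triv_left mult_1 one_power2)
    have "\<not> (p dvd Y - X \<and> p dvd Y + X)"
    proof
      assume "p dvd Y - X \<and> p dvd Y + X"
      then have "p dvd (Y + X) - (Y - X)" using dvd_diff by blast
      then have "p dvd 2 * X" by simp
      then have "p dvd 2" using p pX prime_dvd_mult_iff by blast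
      then show False using False p by (metis primes_dvd_imp_eq two_is_prime_nat
        prime_int_numeral_eq)
    qed
    then show ?thesis using d cop
      by (metis \<open>D = 1\<close> coprime_dvd_mult_left_iff coprime_dvd_mult_right_iff mult_1)
  next
    case True
    then have [simp]: "D = 2" using DE by auto
    have odd: "odd X" "odd A" "odd C" using pX pA pC True by auto
    have "even (A * X\<^sup>2 + C * Y\<^sup>2)" using N by simp
    then have "odd Y" using odd by auto
    then obtain u v where uv: "Y - X = 2 * u" "Y + X = 2 * v"
      using odd by (metis dvdE even_add even_diff)
    have "A * (u * v) = 2 ^ h * (Y\<^sup>2 - 2 ^ (n - h))"
      using eq True unfolding uv by simp
    then have d: "2 ^ h dvd u * v"
      using cop[OF pA, of h] True by (metis coprime_dvd_mult_right_iff dvd_triv_left)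
    have "v = u + X" using uv by simp
    then have "odd u \<or> odd v" using odd by auto
    then have "2 ^ h dvd u \<or> 2 ^ h dvd v" using d cop True
      by (metis coprime_dvd_mult_left_iff coprime_dvd_mult_right_iff)
    then show ?thesis unfolding uv using True by auto
  qed
qed

text \<open>
  What remains after splitting off \<open>\<alpha>^2\<close> is either a unit, which can only happen for \<open>A = 1\<close>, or an element to
  which the descent applies again. It cannot lie in the conjugate prime ideal, since then \<open>p\<close> would divide the
  original element.
\<close>
lemma descended_pair:
  assumes N: "A * X'\<^sup>2 + C * Y'\<^sup>2 = D\<^sup>2 * p ^ e"
    and eX: "D\<^sup>2 * X = (A - C) * X' - 2 * C * Y'" and pX: "\<not> p dvd X"
  shows "e = 0 \<and> A = 1 \<and> X'\<^sup>2 = 1 \<and> Y' = 0 \<or> \<not> p dvd X' \<and> h \<le> e \<and> D * p ^ h dvd Y' - X'"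
proof -
  have nonneg: "0 \<le> A * X'\<^sup>2" "0 \<le> C * Y'\<^sup>2" using A C by auto
  \<comment> \<open>An element with both coordinates nonzero has at least the norm of \<open>\<alpha>\<close>.\<close>
  have big: "h \<le> e" if "X' \<noteq> 0" "Y' \<noteq> 0"
  proof -
    have "1 \<le> X'\<^sup>2" "1 \<le> Y'\<^sup>2" using that one_le_square by auto
    then have "A * 1 \<le> A * X'\<^sup>2" "C * 1 \<le> C * Y'\<^sup>2" using A C by (intro mult_left_mono; simp)+
    then have "D\<^sup>2 * p ^ h \<le> D\<^sup>2 * p ^ e" using N AC by linarith
    then have "p ^ h \<le> p ^ e" using D_pos by simp
    then show ?thesis using p_gt1 power_le_imp_le_exp by blast
  qed
  have unit: "B = 1 \<and> x\<^sup>2 = 1 \<and> y = 0" if "B * x\<^sup>2 + C * y\<^sup>2 = 1" "1 \<le> B" for B x y :: int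
  proof -
    have "y = 0"
    proof (rule ccontr)
      assume "y \<noteq> 0"
      then have "1 \<le> y\<^sup>2" by (rule one_le_square)
      then have "C * 1 \<le> C * y\<^sup>2" using C by (intro mult_left_mono) auto
      moreover have "0 \<le> B * x\<^sup>2" using that by auto
      ultimately show False using that C by linarith
    qed
    then have "B * x\<^sup>2 = 1" using that by simp
    moreover have "0 < B" using that by simp
    ultimately show ?thesis using \<open>y = 0\<close> pos_zmult_eq_1_iff[of B "x\<^sup>2"] by blast
  qed
  have nd: "\<not> p dvd X' \<and> \<not> p dvd Y'" if "\<not> (e = 0 \<and> D = 1)"
  proof (cases "D = 1")
    case True
    then have e: "p dvd p ^ e" using that by (simp add: dvd_power)
    have sq: "p dvd x" if "p dvd x\<^sup>2" for x using that p prime_dvd_power by blast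
    have "p dvd X'" if "p dvd Y'"
    proof -
      have "A * X'\<^sup>2 = p ^ e - C * Y' * Y'" using N True by (simp add: power2_eq_square)
      then have "p dvd A * X'\<^sup>2" using e that by simp
      then show ?thesis using pA p sq by (simp add: prime_dvd_mult_iff)
    qed
    moreover have "p dvd Y'" if "p dvd X'"
    proof -
      have "C * Y'\<^sup>2 = p ^ e - A * X' * X'" using N True by (simp add: power2_eq_square)
      then have "p dvd C * Y'\<^sup>2" using e that by simp
      then show ?thesis using pC p sq by (simp add: prime_dvd_mult_iff)
    qed
    moreover have "X = (A - C) * X' - 2 * C * Y'" using eX True by simp
    then have "\<not> (p dvd X' \<and> p dvd Y')" using pX by (metis dvd_diff dvd_mult)
    ultimately show ?thesis by blast
  next
    case False
    then have [simp]: "D = 2" "p = 2" and A2: "2 \<le> A" using DE by auto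
    have odd: "odd A" "odd C" using pA pC by auto
    have "odd X' \<and> odd Y'"
    proof (rule ccontr)
      assume "\<not> (odd X' \<and> odd Y')"
      moreover have "even (A * X'\<^sup>2 + C * Y'\<^sup>2)" using N by simp
      ultimately have "even X'" "even Y'" using odd by auto
      then obtain a a' where a: "X' = 2 * a" "Y' = 2 * a'" by blast
      have N': "A * a\<^sup>2 + C * a'\<^sup>2 = 2 ^ e" using N by (simp add: a power_mult_distrib)
      have "e \<noteq> 0" using unit[of A a a'] N' A2 by auto
      then have "even (A * a\<^sup>2 + C * a'\<^sup>2)" using N' by simp
      then have aa: "even a \<longleftrightarrow> even a'" using odd by auto
      have "A - C = 2 * (A - 2 * 2 ^ h)" using AC by simp
      then have "4 * X = 4 * ((A - 2 * 2 ^ h) * a - C * a')" using eX unfolding a by (simp add: algebra_simps)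
      then have "X = (A - 2 * 2 ^ h) * a - C * a'" by simp
      then show False using pX aa odd by auto
    qed
    then show ?thesis by simp
  qed
  show ?thesis
  proof (cases "e = 0 \<and> D = 1")
    case True
    then show ?thesis using unit[of A X' Y'] N A by simp
  next
    case False
    then have "\<not> p dvd X'" "\<not> p dvd Y'" using nd by auto
    then have "h \<le> e" using big by auto
    have "\<not> D * p ^ h dvd Y' + X'"
    proof
      assume "D * p ^ h dvd Y' + X'"
      then obtain V where "Y' + X' = D * p ^ h * V" by (elim dvdE)
      then have V: "Y' = D * p ^ h * V - X'" by linarith
      have "D\<^sup>2 * X = (A + C) * X' - (D * E) * C * D * p ^ h * V"
        unfolding eX ED V by (simp add: algebra_simps)
      also have "\<dots> = D\<^sup>2 * (p ^ h * (X' - E * C * V))"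
        by (simp add: AC algebra_simps power2_eq_square)
      finally have "X = p ^ h * (X' - E * C * V)" using D_pos by simp
      then show False using pX h by (simp add: dvd_power)
    qed
    then show ?thesis using prime_power_dvd_difference_or_sum[OF N \<open>h \<le> e\<close> \<open>\<not> p dvd X'\<close>]
      \<open>\<not> p dvd X'\<close> \<open>h \<le> e\<close> by blast
  qed
qed

text \<open>
  Descent on the norm. Let \<open>Y = X + D p^h V\<close>, so the element is \<open>\<alpha>\<close> times
  \<open>\<omega> = (D X + C V + V \<surd>(-A C)) / D\<close>. If \<open>n < 2h\<close>, the norm of \<open>\<omega>\<close> is too small for \<open>V \<noteq> 0\<close>
  (for \<open>A = 1\<close> one also needs that \<open>C\<close> does not divide a power of \<open>p\<close>), and the element is \<open>\<plusminus>\<alpha>\<close>. Otherwise \<open>\<omega>\<close> is again divisible by \<open>\<alpha>\<close>, and one continues with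
  the quotient by \<open>\<alpha>^2\<close>, which again has the shape \<open>X \<surd>A + Y \<surd>(-C)\<close> up to \<open>D\<close>.
\<close>
lemma descent:
  assumes "A * X\<^sup>2 + C * Y\<^sup>2 = D\<^sup>2 * p ^ n" "h \<le> n" "\<not> p dvd X" "D * p ^ h dvd Y - X"
  shows "\<exists>j. 1 \<le> j \<and> (2 \<le> A \<longrightarrow> odd j) \<and> n = j * h \<and> (elt X Y = \<alpha> ^ j \<or> elt X Y = - (\<alpha> ^ j))"
  using assms
proof (induction n arbitrary: X Y rule: less_induct)
  case (less n)
  note N = less.prems(1) and hn = less.prems(2) and pX = less.prems(3)
  define P where "P = p ^ h"
  have P0: "0 < P" using p_gt1 by (simp add: P_def)
  have ACP: "A + C = D\<^sup>2 * P" by (simp add: AC P_def)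
  obtain V where "Y - X = D * p ^ h * V" using less.prems(4) by (elim dvdE)
  then have V: "Y = X + D * P * V" by (simp add: P_def algebra_simps)
  \<comment> \<open>The coordinates of \<open>\<omega>\<close> times the conjugate of \<open>\<alpha>\<close>, that is, of \<open>p^h\<close> times the quotient by \<open>\<alpha>^2\<close>.\<close>
  define X2 where "X2 = X + E * C * V"
  define Y2 where "Y2 = E * A * V - Y"
  have pn: "p ^ n = P * p ^ (n - h)" using hn by (simp add: P_def flip: power_add)
  have DE': "D\<^sup>2 * E = 2 * D" using ED by (simp add: power2_eq_square mult.assoc mult.commute)
  have "D\<^sup>2 * P * (X * X2 + C * P * V\<^sup>2) = (A + C) * X\<^sup>2 + C * P * X * V * (D\<^sup>2 * E) + C * D\<^sup>2 * P\<^sup>2 * V\<^sup>2"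
    unfolding ACP X2_def by (simp add: algebra_simps power2_eq_square)
  also have "\<dots> = A * X\<^sup>2 + C * Y\<^sup>2"
    unfolding DE' V by (simp add: algebra_simps power2_eq_square)
  also have "\<dots> = D\<^sup>2 * P * p ^ (n - h)" by (simp add: N pn)
  finally have XX2: "X * X2 + C * P * V\<^sup>2 = p ^ (n - h)" using P0 D_pos by simp
  have E2: "E * D = 2" using ED by (simp add: mult.commute)
  have "A * X2\<^sup>2 + C * Y2\<^sup>2 = A * X\<^sup>2 + C * Y\<^sup>2 + 2 * A * C * E * V * (X - Y) + A * C * E\<^sup>2 * V\<^sup>2 * (A + C)"
    unfolding X2_def Y2_def by (simp add: algebra_simps power2_eq_square)
  also have "\<dots> = A * X\<^sup>2 + C * Y\<^sup>2 - 2 * A * C * P * V\<^sup>2 * (E * D) + A * C * P * V\<^sup>2 * (E * D)\<^sup>2"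
    unfolding ACP unfolding V by (simp add: algebra_simps power2_eq_square)
  finally have N2: "A * X2\<^sup>2 + C * Y2\<^sup>2 = D\<^sup>2 * p ^ n" using N by (simp add: E2)
  have cop: "coprime (p ^ k) x" if "\<not> p dvd x" for x k
    using p that by (simp add: prime_imp_coprime)
  show ?case
  proof (cases "n < 2 * h")
    case True
    \<comment> \<open>The norm of \<open>\<omega>\<close>, here less than that of \<open>\<alpha>\<close>.\<close>
    have "(D * X + C * V)\<^sup>2 + A * C * V\<^sup>2 = D\<^sup>2 * X\<^sup>2 + 2 * D * C * X * V + C * V\<^sup>2 * (A + C)"
      by (simp add: algebra_simps power2_eq_square)
    also have "\<dots> = D\<^sup>2 * (X * X2 + C * P * V\<^sup>2)"
    proof -
      have "D\<^sup>2 * (X * X2 + C * P * V\<^sup>2)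
          = D\<^sup>2 * X\<^sup>2 + C * X * V * (D\<^sup>2 * E) + C * V\<^sup>2 * (D\<^sup>2 * P)"
        unfolding X2_def by (simp add: algebra_simps power2_eq_square)
      then show ?thesis unfolding DE' ACP by (simp add: algebra_simps)
    qed
    finally have U: "(D * X + C * V)\<^sup>2 + A * C * V\<^sup>2 = D\<^sup>2 * p ^ (n - h)" using XX2 by simp
    have "p ^ (n - h) < P" unfolding P_def using True hn p_gt1
      by (intro power_strict_increasing) auto
    then have lt: "(D * X + C * V)\<^sup>2 + A * C * V\<^sup>2 < A + C" using U D_pos ACP by simp
    have "V = 0"
    proof (rule ccontr)
      assume "V \<noteq> 0"
      then have V1: "1 \<le> V\<^sup>2" by (rule one_le_square)
      have "A * C \<le> A * C * V\<^sup>2" using V1 A C by simp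
      then have "A * C + (D * X + C * V)\<^sup>2 < A + C" using lt by simp
      moreover have "A * C - A - C = (A - 1) * (C - 1) - 1" by (simp add: algebra_simps)
      moreover have "0 \<le> (D * X + C * V)\<^sup>2" by simp
      ultimately have small: "(A - 1) * (C - 1) + (D * X + C * V)\<^sup>2 < 1" by linarith
      have A1: "A = 1"
      proof (rule ccontr)
        assume "A \<noteq> 1"
        then have "1 * 1 \<le> (A - 1) * (C - 1)" using A C by (intro mult_mono) auto
        then show False using small zero_le_power2[of "D * X + C * V"] by linarith
      qed
      then have D1: "D = 1" using DE by auto
      have "(D * X + C * V)\<^sup>2 < 1" using small A1 by simp
      then have "(D * X + C * V)\<^sup>2 = 0" using zero_le_power2[of "D * X + C * V"] by linarith
      then have CV: "C * V\<^sup>2 = p ^ (n - h)" using U A1 D1 by simp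
      then have "C dvd p ^ (n - h)" by (metis dvd_triv_left)
      moreover have "coprime (p ^ (n - h)) C" by (rule cop[OF pC])
      ultimately have "is_unit C" by (metis coprime_absorb_right)
      then show False using C by simp
    qed
    then have XY: "Y = X" using V by simp
    have X2n: "X\<^sup>2 = p ^ (n - h)" using XX2 \<open>V = 0\<close> by (simp add: X2_def power2_eq_square)
    have "n - h = 0"
    proof (rule ccontr)
      assume "n - h \<noteq> 0"
      then have "p dvd X\<^sup>2" using X2n by (simp add: dvd_power)
      then show False using pX p prime_dvd_power by blast
    qed
    then have "n = 1 * h" "X\<^sup>2 = 1" using hn X2n by auto
    then have "n = 1 * h" "X = 1 \<or> X = -1" by (auto simp: power2_eq_1_iff)
    then show ?thesis using XY elt_neg[of 1 1]
      by (intro exI[of _ 1]) auto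
  next
    case False
    \<comment> \<open>The product of \<open>X\<close> and \<open>X2\<close> is divisible by \<open>p^h\<close> and \<open>X\<close> is prime to \<open>p\<close>; the norm then
        handles \<open>Y2\<close>.\<close>
    have "P dvd p ^ (n - h)" unfolding P_def using False by (intro le_imp_power_dvd) simp
    then have "P dvd p ^ (n - h) - C * P * V\<^sup>2" by simp
    then have "P dvd X * X2" by (simp flip: XX2)
    then have "P dvd X2" unfolding P_def using cop[OF pX] coprime_dvd_mult_right_iff by blast
    then obtain X3 where X3: "X2 = P * X3" by blast
    have pnP: "p ^ n = P\<^sup>2 * p ^ (n - 2 * h)" using False
      by (simp add: P_def flip: power_add power_mult mult.commute[of 2])
    have "P\<^sup>2 dvd C * Y2\<^sup>2"
    proof -
      have "C * Y2\<^sup>2 = P\<^sup>2 * (D\<^sup>2 * p ^ (n - 2 * h) - A * X3\<^sup>2)"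
        using N2 X3 pnP by (simp add: algebra_simps)
      then show ?thesis by simp
    qed
    then have "P\<^sup>2 dvd Y2\<^sup>2" using cop[OF pC, of "h * 2"] coprime_dvd_mult_right_iff
      unfolding P_def by (metis power_mult)
    then have "P dvd Y2" by simp
    then obtain Y3 where Y3: "Y2 = P * Y3" by blast
    have "P\<^sup>2 * (A * X3\<^sup>2 + C * Y3\<^sup>2) = P\<^sup>2 * (D\<^sup>2 * p ^ (n - 2 * h))"
      using N2 X3 Y3 pnP by (simp add: algebra_simps power_mult_distrib)
    then have N3: "A * X3\<^sup>2 + C * Y3\<^sup>2 = D\<^sup>2 * p ^ (n - 2 * h)" using P0 by simp
    have e2: "E * D\<^sup>2 = 2 * D" using E2 by (simp add: power2_eq_square mult.assoc[symmetric])
    have "P * ((A - C) * X3 - 2 * C * Y3) = (A - C) * X2 - 2 * C * Y2"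
      by (simp add: X3 Y3 algebra_simps)
    also have "\<dots> = (A - C) * X + 2 * C * Y - C * V * E * (A + C)"
      by (simp add: X2_def Y2_def algebra_simps)
    also have "\<dots> = (A - C) * X + 2 * C * Y - C * V * P * (E * D\<^sup>2)"
      by (simp add: ACP algebra_simps)
    also have "\<dots> = (A + C) * X" unfolding e2 V by (simp add: algebra_simps)
    also have "\<dots> = P * (D\<^sup>2 * X)" by (simp add: ACP)
    finally have eX: "D\<^sup>2 * X = (A - C) * X3 - 2 * C * Y3" using P0 by simp
    have "P * ((A - C) * Y3 + 2 * A * X3) = (A - C) * Y2 + 2 * A * X2"
      by (simp add: X3 Y3 algebra_simps)
    also have "\<dots> = (C - A) * Y + 2 * A * X + A * V * E * (A + C)"
      by (simp add: X2_def Y2_def algebra_simps)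
    also have "\<dots> = (C - A) * Y + 2 * A * X + A * V * P * (E * D\<^sup>2)"
      by (simp add: ACP algebra_simps)
    also have "\<dots> = (A + C) * Y" unfolding e2 V by (simp add: algebra_simps)
    also have "\<dots> = P * (D\<^sup>2 * Y)" by (simp add: ACP)
    finally have eY: "D\<^sup>2 * Y = (A - C) * Y3 + 2 * A * X3" using P0 by simp
    note step = elt_square_mult[OF eX eY]
    from descended_pair[OF N3 eX pX] show ?thesis
    proof
      assume 1: "n - 2 * h = 0 \<and> A = 1 \<and> X3\<^sup>2 = 1 \<and> Y3 = 0"
      then have "D = 1" using DE by auto
      then have "elt X3 Y3 = Complex X3 0" unfolding elt_def using 1 by simp
      then have "elt X3 Y3 = 1 \<or> elt X3 Y3 = -1"
        using 1 by (auto simp: power2_eq_1_iff complex_eq_iff)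
      then have "elt X Y = \<alpha> ^ 2 \<or> elt X Y = - (\<alpha> ^ 2)" using step by auto
      then show ?thesis using 1 False by (intro exI[of _ 2]) auto
    next
      assume 2: "\<not> p dvd X3 \<and> h \<le> n - 2 * h \<and> D * p ^ h dvd Y3 - X3"
      then have 3: "h \<le> n - 2 * h" "\<not> p dvd X3" "D * p ^ h dvd Y3 - X3" by auto
      have "n - 2 * h < n" using h False by simp
      from less.IH[OF this N3 3] obtain j where j: "1 \<le> j" "2 \<le> A \<longrightarrow> odd j"
        "n - 2 * h = j * h" "elt X3 Y3 = \<alpha> ^ j \<or> elt X3 Y3 = - (\<alpha> ^ j)" by blast
      have "n = (2 + j) * h" using j(3) False by (simp add: algebra_simps)
      moreover have "elt X Y = \<alpha> ^ (2 + j) \<or> elt X Y = - (\<alpha> ^ (2 + j))"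
        using j(4) unfolding step power_add by (elim disjE) simp_all
      ultimately show ?thesis using j by (intro exI[of _ "2 + j"]) auto
    qed
  qed
qed

end

section \<open>Real and imaginary parts of odd powers\<close>

text \<open>
  For \<open>M = (2 Re z)^2\<close> and \<open>T = |z|^2\<close> these are the integers \<open>Re (z^(2k+1)) / Re z\<close> and
  \<open>Im (z^(2k+1)) / Im z\<close>. The recurrence holds because \<open>z^2\<close> has trace \<open>M - 2 T\<close> and norm \<open>T^2\<close>.
\<close>
fun re_quot :: "int \<Rightarrow> int \<Rightarrow> nat \<Rightarrow> int" where
  "re_quot M T 0 = 1"
| "re_quot M T (Suc 0) = M - 3 * T"
| "re_quot M T (Suc (Suc k)) = (M - 2 * T) * re_quot M T (Suc k) - T\<^sup>2 * re_quot M T k"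

fun im_quot :: "int \<Rightarrow> int \<Rightarrow> nat \<Rightarrow> int" where
  "im_quot M T 0 = 1"
| "im_quot M T (Suc 0) = M - T"
| "im_quot M T (Suc (Suc k)) = (M - 2 * T) * im_quot M T (Suc k) - T\<^sup>2 * im_quot M T k"

lemma odd_power_parts:
  fixes z :: complex
  assumes M: "real_of_int M = (2 * Re z)\<^sup>2" and T: "real_of_int T = (Re z)\<^sup>2 + (Im z)\<^sup>2"
  shows "Re (z ^ (2 * k + 1)) = Re z * re_quot M T k"
    and "Im (z ^ (2 * k + 1)) = Im z * im_quot M T k"
proof -
  let ?t = "real_of_int (M - 2 * T)" and ?n = "real_of_int (T\<^sup>2)"
  have t: "?t = 2 * ((Re z)\<^sup>2 - (Im z)\<^sup>2)" and n: "?n = ((Re z)\<^sup>2 + (Im z)\<^sup>2)\<^sup>2"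
    by (simp_all add: M T power_mult_distrib)
  have "z ^ 4 = complex_of_real ?t * z\<^sup>2 - complex_of_real ?n"
    unfolding t n by (simp add: complex_eq_iff power4_eq_xxxx power2_eq_square algebra_simps)
  then have "z ^ 4 * z ^ (2 * k + 1) = complex_of_real ?t * (z\<^sup>2 * z ^ (2 * k + 1)) - complex_of_real ?n * z ^ (2 * k + 1)" for k
    by (simp only: left_diff_distrib mult.assoc)
  moreover have "z ^ 4 * z ^ (2 * k + 1) = z ^ (2 * Suc (Suc k) + 1)" "z\<^sup>2 * z ^ (2 * k + 1) = z ^ (2 * Suc k + 1)" for k
    by (subst power_add[symmetric], rule arg_cong[of _ _ "power z"], simp)+
  ultimately have "z ^ (2 * Suc (Suc k) + 1) = complex_of_real ?t * z ^ (2 * Suc k + 1) - complex_of_real ?n * z ^ (2 * k + 1)" for k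
    by (simp only:)
  then have step: "Re (z ^ (2 * Suc (Suc k) + 1)) = ?t * Re (z ^ (2 * Suc k + 1)) - ?n * Re (z ^ (2 * k + 1))"
     "Im (z ^ (2 * Suc (Suc k) + 1)) = ?t * Im (z ^ (2 * Suc k + 1)) - ?n * Im (z ^ (2 * k + 1))" for k
    by (simp_all del: of_int_diff of_int_power of_int_mult)
  have cube: "Re (z ^ 3) = Re z * (M - 3 * T)" "Im (z ^ 3) = Im z * (M - T)"
    by (simp_all add: M T power3_eq_cube power2_eq_square algebra_simps)
  show "Re (z ^ (2 * k + 1)) = Re z * re_quot M T k"
  proof (induction k rule: induct_nat_012)
    case (ge2 k)
    then show ?case unfolding step by (simp add: algebra_simps)
  qed (use cube in \<open>simp_all add: eval_nat_numeral\<close>)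
  show "Im (z ^ (2 * k + 1)) = Im z * im_quot M T k"
  proof (induction k rule: induct_nat_012)
    case (ge2 k)
    then show ?case unfolding step by (simp add: algebra_simps)
  qed (use cube in \<open>simp_all add: eval_nat_numeral\<close>)
qed

context
  fixes M T :: int
  assumes M: "0 < M" and MT: "M < 4 * T"
begin

text \<open>
  A complex number that realises given parameters \<open>M\<close> and \<open>T\<close>. Through it, identities between the two sequences
  follow from the laws of powers.
\<close>
definition lucas_root :: complex where
  "lucas_root = Complex (sqrt M / 2) (sqrt (4 * T - M) / 2)"

lemma lucas_root_parts: "real_of_int M = (2 * Re lucas_root)\<^sup>2" "real_of_int T = (Re lucas_root)\<^sup>2 + (Im lucas_root)\<^sup>2"
    "real_of_int (4 * T - M) = (2 * Im lucas_root)\<^sup>2" "Re lucas_root \<noteq> 0" "Im lucas_root \<noteq> 0"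
proof -
  have "0 < real_of_int M" "0 < real_of_int (4 * T - M)" using M MT by (simp_all only: of_int_0_less_iff)
  then show "real_of_int M = (2 * Re lucas_root)\<^sup>2" "real_of_int T = (Re lucas_root)\<^sup>2 + (Im lucas_root)\<^sup>2"
    "real_of_int (4 * T - M) = (2 * Im lucas_root)\<^sup>2" "Re lucas_root \<noteq> 0" "Im lucas_root \<noteq> 0"
    by (simp_all add: lucas_root_def power_divide diff_divide_distrib)
qed

lemma quot_norm:
  "M * (re_quot M T k)\<^sup>2 + (4 * T - M) * (im_quot M T k)\<^sup>2 = 4 * T ^ (2 * k + 1)"
proof -
  let ?w = "lucas_root ^ (2 * k + 1)"
  have "4 * ((Re ?w)\<^sup>2 + (Im ?w)\<^sup>2) = 4 * ((cmod lucas_root)\<^sup>2) ^ (2 * k + 1)"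
    by (simp only: cmod_power2[symmetric] norm_power power_mult[symmetric] mult.commute)
  then have "(2 * Re lucas_root)\<^sup>2 * (re_quot M T k)\<^sup>2 + (2 * Im lucas_root)\<^sup>2 * (im_quot M T k)\<^sup>2 = 4 * T ^ (2 * k + 1)"
    unfolding odd_power_parts[OF lucas_root_parts(1,2)] cmod_power2 lucas_root_parts(2)[symmetric]
    by (simp add: power_mult_distrib algebra_simps)
  then have "real_of_int (M * (re_quot M T k)\<^sup>2 + (4 * T - M) * (im_quot M T k)\<^sup>2) = of_int (4 * T ^ (2 * k + 1))"
    unfolding lucas_root_parts(1,3)[symmetric] by simp
  then show ?thesis by (simp only: of_int_eq_iff)
qed

text \<open>
  The law \<open>z^((2i+1)(2l+1)) = (z^(2i+1))^(2l+1)\<close>, where \<open>z^(2i+1)\<close> has its own parameters.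
\<close>
lemma quot_mult:
  assumes "2 * k + 1 = (2 * i + 1) * (2 * l + 1)"
  shows "re_quot M T k = re_quot M T i * re_quot (M * (re_quot M T i)\<^sup>2) (T ^ (2 * i + 1)) l"
    and "im_quot M T k = im_quot M T i * im_quot (M * (re_quot M T i)\<^sup>2) (T ^ (2 * i + 1)) l"
proof -
  let ?w = "lucas_root ^ (2 * i + 1)" and ?M = "M * (re_quot M T i)\<^sup>2" and ?T = "T ^ (2 * i + 1)"
  have 1: "real_of_int ?M = (2 * Re ?w)\<^sup>2"
    unfolding odd_power_parts[OF lucas_root_parts(1,2)]
    by (simp add: power_mult_distrib lucas_root_parts(1))
  have "real_of_int ?T = (cmod lucas_root ^ 2) ^ (2 * i + 1)"
    by (simp add: cmod_power2 lucas_root_parts(2))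
  also have "\<dots> = (cmod ?w)\<^sup>2" by (simp only: norm_power power_mult[symmetric] mult.commute)
  finally have 2: "real_of_int ?T = (Re ?w)\<^sup>2 + (Im ?w)\<^sup>2" by (simp only: cmod_power2)
  have pow: "lucas_root ^ (2 * k + 1) = ?w ^ (2 * l + 1)" by (simp only: assms power_mult)
  have "Re lucas_root * re_quot M T k = Re ?w * re_quot ?M ?T l"
    by (simp only: odd_power_parts(1)[OF lucas_root_parts(1,2), symmetric] pow odd_power_parts(1)[OF 1 2])
  then have "real_of_int (re_quot M T k) = of_int (re_quot M T i * re_quot ?M ?T l)"
    unfolding odd_power_parts(1)[OF lucas_root_parts(1,2)] using lucas_root_parts(4) by simp
  then show "re_quot M T k = re_quot M T i * re_quot ?M ?T l" by (simp only: of_int_eq_iff)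
  have "Im lucas_root * im_quot M T k = Im ?w * im_quot ?M ?T l"
    by (simp only: odd_power_parts(2)[OF lucas_root_parts(1,2), symmetric] pow odd_power_parts(2)[OF 1 2])
  then have "real_of_int (im_quot M T k) = of_int (im_quot M T i * im_quot ?M ?T l)"
    unfolding odd_power_parts(2)[OF lucas_root_parts(1,2)] using lucas_root_parts(5) by simp
  then show "im_quot M T k = im_quot M T i * im_quot ?M ?T l" by (simp only: of_int_eq_iff)
qed

end

text \<open>
  Modulo \<open>M\<close> the recurrence has the double characteristic root \<open>-T\<close>, so its solution is \<open>(-T)^k\<close> times a
  linear function of \<open>k\<close>.
\<close>
lemma re_quot_mod: "[re_quot M T k = (- T) ^ k * (2 * int k + 1)] (mod M)"
proof -
  have "\<exists>z. re_quot M T k = (- T) ^ k * (2 * int k + 1) + M * z"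
  proof (induction k rule: induct_nat_012)
    case 0
    show ?case by simp
  next
    case 1
    show ?case by (intro exI[of _ 1]) simp
  next
    case (ge2 k)
    then obtain u v where uv: "re_quot M T k = (- T) ^ k * (2 * int k + 1) + M * u"
      "re_quot M T (Suc k) = (- T) ^ Suc k * (2 * int (Suc k) + 1) + M * v" by blast
    show ?case unfolding re_quot.simps uv
      by (intro exI[of _ "(- T) ^ Suc k * (2 * int (Suc k) + 1) + M * v - 2 * T * v - T\<^sup>2 * u"])
         (simp add: algebra_simps power2_eq_square)
  qed
  then show ?thesis by (auto simp: cong_iff_dvd_diff)
qed

text \<open>
  As a polynomial in \<open>M\<close>, the quotient has linear coefficient \<open>k (k + 1) (2k + 1) / 6\<close> times \<open>(-T)^(k-1)\<close>; the factor \<open>6 T\<close>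
  clears the denominator and avoids the exponent \<open>k - 1\<close>.
\<close>
lemma re_quot_mod_square:
  "M\<^sup>2 dvd 6 * T * re_quot M T k
    - (- T) ^ k * (2 * int k + 1) * (6 * T - int k * (int k + 1) * M)"
proof -
  have "\<exists>z. 6 * T * re_quot M T k
    = (- T) ^ k * (2 * int k + 1) * (6 * T - int k * (int k + 1) * M) + M\<^sup>2 * z"
  proof (induction k rule: induct_nat_012)
    case 0
    show ?case by simp
  next
    case 1
    show ?case by (intro exI[of _ 0]) (simp add: algebra_simps)
  next
    case (ge2 k)
    then obtain u v where
      "6 * T * re_quot M T k = (- T) ^ k * (2 * int k + 1) * (6 * T - int k * (int k + 1) * M) + M\<^sup>2 * u"
      "6 * T * re_quot M T (Suc k) = (- T) ^ Suc k * (2 * int (Suc k) + 1) * (6 * T - int (Suc k) * (int (Suc k) + 1) * M) + M\<^sup>2 * v"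
      by blast
    note uv = this
    have "6 * T * re_quot M T (Suc (Suc k)) = (M - 2 * T) * (6 * T * re_quot M T (Suc k)) - T\<^sup>2 * (6 * T * re_quot M T k)"
      by (simp add: algebra_simps)
    then show ?case unfolding uv
      by (intro exI[of _ "(M - 2 * T) * v - T\<^sup>2 * u - (- T) ^ Suc k * (2 * int (Suc k) + 1) * int (Suc k) * (int (Suc k) + 1)"])
         (simp add: algebra_simps power2_eq_square)
  qed
  then show ?thesis by auto
qed


section \<open>Odd powers whose real part grows by a power of a given number\<close>

lemma all_prime_divisors_eq_imp_power:
  fixes W q :: int
  assumes q: "prime q" and W: "W \<noteq> 0" and *: "\<And>l. prime l \<Longrightarrow> l dvd W \<Longrightarrow> l = q"
  shows "\<exists>t. \<bar>W\<bar> = q ^ t"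
proof -
  have q1: "1 < q" using q prime_gt_1_int by blast
  obtain t V where V: "W = q ^ t * V" "\<not> q dvd V"
    using multiplicity_decompose'[of W q] W q1 q by (metis not_prime_unit zdvd1_eq abs_1)
  have "is_unit V"
  proof (rule ccontr)
    assume "\<not> is_unit V"
    moreover have "V \<noteq> 0" using V W by auto
    ultimately obtain l where l: "prime l" "l dvd V" using prime_divisor_exists by blast
    then have "l = q" using * V by simp
    then show False using l V by simp
  qed
  then have "\<bar>V\<bar> = 1" by simp
  then show ?thesis using V q1 by (intro exI[of _ t]) (simp add: abs_mult)
qed

lemma square_le_exp3: "4 \<le> n \<Longrightarrow> int (n + 1) ^ 2 < 3 ^ n"
proof (induction n rule: nat_induct_at_least)
  case base
  show ?case by simp
next
  case (Suc n)
  have "4 * int n \<le> int n * int n" using Suc.hyps by (intro mult_right_mono) auto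
  moreover have "int (Suc n + 1) ^ 2 = int n * int n + 4 * int n + 4"
    "int (n + 1) ^ 2 = int n * int n + 2 * int n + 1"
    by (simp_all add: power2_eq_square algebra_simps)
  ultimately have "int (Suc n + 1) ^ 2 \<le> 3 * int (n + 1) ^ 2" using Suc.hyps by linarith
  then show ?case using Suc.IH by simp
qed

lemma square_le_exp2: "6 \<le> n \<Longrightarrow> int (n + 1) ^ 2 < 2 ^ n"
proof (induction n rule: nat_induct_at_least)
  case base
  show ?case by simp
next
  case (Suc n)
  have "6 * int n \<le> int n * int n" using Suc.hyps by (intro mult_right_mono) auto
  moreover have "int (Suc n + 1) ^ 2 = int n * int n + 4 * int n + 4"
    "int (n + 1) ^ 2 = int n * int n + 2 * int n + 1"
    by (simp_all add: power2_eq_square algebra_simps)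
  ultimately have "int (Suc n + 1) ^ 2 \<le> 2 * int (n + 1) ^ 2" using Suc.hyps by linarith
  then show ?case using Suc.IH by simp
qed

text \<open>
  Modulo \<open>q^2\<close> the quotient is \<open>q\<close> times a unit: the coefficient of \<open>M\<close> is divisible by \<open>q\<close> when
  \<open>q \<ge> 5\<close>. For \<open>q = 3\<close> that coefficient is \<open>1\<close>, whence the stronger hypothesis on \<open>M\<close>.
\<close>
lemma primitive_prime_quotient:
  fixes M T q :: int
  assumes q: "prime q" "q = 2 * int l + 1" "q dvd M" "coprime M T"
    and *: "5 \<le> q \<or> 9 dvd M"
  shows "\<not> q\<^sup>2 dvd re_quot M T l"
proof
  assume d: "q\<^sup>2 dvd re_quot M T l"
  have qT: "\<not> q dvd T" using q not_coprimeI not_prime_unit by blast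
  have ql: "\<not> q dvd (- T) ^ i" for i using qT q prime_dvd_power dvd_minus_iff by blast
  have "q \<noteq> 2" using q(2) by presburger
  moreover have "2 \<le> q" using q prime_ge_2_int by blast
  moreover have "\<not> prime (4 :: int)"
    using primes_dvd_imp_eq[of 2 "4 :: int"] by auto
  ultimately consider "5 \<le> q" | "q = 3"
    using q(1) by (cases "q = 4"; cases "q = 3") auto
  then show False
  proof cases
    case 1
    have "q\<^sup>2 dvd M\<^sup>2" using q by simp
    then have "q\<^sup>2 dvd 6 * T * re_quot M T l
        - (- T) ^ l * q * (6 * T - int l * (int l + 1) * M)"
      using re_quot_mod_square[of M T l] unfolding q(2) by (rule dvd_trans)
    then have "q\<^sup>2 dvd (- T) ^ l * q * (6 * T - int l * (int l + 1) * M)"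
      using d by (metis dvd_diff_right_iff dvd_mult)
    then have "q dvd (- T) ^ l * (6 * T - int l * (int l + 1) * M)"
      using \<open>2 \<le> q\<close> by (simp add: power2_eq_square mult.assoc mult.left_commute[of _ q])
    then have "q dvd 6 * T - int l * (int l + 1) * M"
      using q(1) ql[of l] prime_dvd_mult_iff by blast
    then have "q dvd 6 * T" using q(3) by (metis dvd_diff_right_iff dvd_mult dvd_diff_left_iff)
    then have "q dvd 2 * 3" using q(1) qT by (simp add: prime_dvd_mult_iff)
    then have "q dvd 2 \<or> q dvd 3" using q(1) prime_dvd_mult_iff by blast
    then show False using 1 zdvd_imp_le by fastforce
  next
    case 2
    then have "l = 1" "9 dvd M" using q * by auto
    then have "9 dvd M - 3 * T" using d 2 by simp
    then have "9 dvd 3 * T" using \<open>9 dvd M\<close> dvd_diff_right_iff by blast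
    then have "3 dvd T" by presburger
    then show False using qT 2 by simp
  qed
qed


text \<open>
  A factor \<open>q\<close> in the real part increases the norm at most \<open>q^2\<close>-fold, whereas taking the \<open>q\<close>-th power multiplies it
  by \<open>T^(q-1)\<close>.
\<close>
lemma power_cofactor_bound:
  fixes M T W q :: int
  assumes M: "0 < M" "M < 4 * T" and W: "M * W\<^sup>2 + (4 * T - M) = 4 * T ^ (2 * l + 1)" and Wq: "\<bar>W\<bar> \<le> q"
    and l: "q = 2 * int l + 1" "1 \<le> l"
  shows "T ^ (2 * l) \<le> int (2 * l + 1) ^ 2"
proof -
  have T: "0 < T" using M by simp
  have "1 \<le> q\<^sup>2" using l one_le_power[of q 2] by simp
  then have "(4 * T - M) * 1 \<le> (4 * T - M) * q\<^sup>2" using M by (intro mult_left_mono) auto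
  moreover have "W\<^sup>2 \<le> q\<^sup>2" using Wq by (simp add: abs_le_square_iff[symmetric])
  then have "M * W\<^sup>2 \<le> M * q\<^sup>2" using M by (intro mult_left_mono) auto
  ultimately have "M * W\<^sup>2 + (4 * T - M) * 1 \<le> M * q\<^sup>2 + (4 * T - M) * q\<^sup>2" by (intro add_mono)
  then have "4 * T ^ (2 * l + 1) \<le> M * q\<^sup>2 + (4 * T - M) * q\<^sup>2" by (simp only: W mult_1_right)
  also have "\<dots> = 4 * T * q\<^sup>2" by (simp add: algebra_simps)
  finally have "T * T ^ (2 * l) \<le> T * q\<^sup>2" by simp
  then have "T ^ (2 * l) \<le> q\<^sup>2" using T by (simp add: mult_le_cancel_left)
  moreover have "int (2 * l + 1) = q" by (simp add: l)
  ultimately show ?thesis by (simp only:)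
qed

text \<open>
  Here \<open>j = 2k + 1\<close>, and \<open>r\<close> is the real quotient of the power of exponent \<open>2i + 1 = j / q\<close> for a prime
  \<open>q\<close> dividing \<open>b\<close>. That power has parameters \<open>M r^2\<close> and \<open>T^(2i+1)\<close>, while \<open>4 T - M\<close>, four times
  the square of the imaginary part, is unchanged. The first alternative is the one case with \<open>q = 5\<close> in which the size estimate does
  not lead to a contradiction; the second one is \<open>q = 3\<close>, where the quotient may be any power of \<open>3\<close>, but the
  imaginary part gives one further equation.
\<close>
lemma re_quot_power_cases:
  fixes b M T :: int
  assumes b: "1 < b" "b dvd M" "coprime M T" and T: "2 \<le> T" and M: "0 < M" "M < 4 * T"
    and re: "\<bar>re_quot M T k\<bar> = b ^ d" "1 \<le> d" and im: "\<bar>im_quot M T k\<bar> = 1"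
  obtains i r where "M * r\<^sup>2 + (4 * T - M) = 4 * T ^ (2 * i + 1)" "M * r\<^sup>2 = 5" "T ^ (2 * i + 1) = 2"
  | i r t e where "M * r\<^sup>2 + (4 * T - M) = 4 * T ^ (2 * i + 1)" "M * r\<^sup>2 = T ^ (2 * i + 1) + e" "e = 1 \<or> e = -1"
    "2 * T ^ (2 * i + 1) = 3 ^ t + e" "\<bar>r\<bar> * 3 ^ t = b ^ d" "\<not> 9 dvd M * r\<^sup>2" "3 dvd b"
proof -
  have bT: "coprime b T" using b by (meson coprime_divisors dvd_refl)
  \<comment> \<open>\<open>b\<close> divides the real quotient, which is \<open>2k + 1\<close> times a unit modulo \<open>b\<close>.\<close>
  have "b dvd re_quot M T k"
  proof -
    have "b dvd b ^ d" using re by (simp add: dvd_power)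
    then show ?thesis using re by (metis dvd_abs_iff)
  qed
  moreover have "b dvd re_quot M T k - (- T) ^ k * (2 * int k + 1)"
    using re_quot_mod[of M T k] b by (auto simp: cong_iff_dvd_diff intro: dvd_trans)
  ultimately have "b dvd (- T) ^ k * (2 * int k + 1)" by (metis dvd_diff_right_iff)
  moreover have "coprime b ((- T) ^ k)" using bT by simp
  ultimately have bj: "b dvd 2 * int k + 1" by (simp add: coprime_dvd_mult_right_iff)
  obtain q where q: "prime q" "q dvd b" using b prime_divisor_exists[of b] by auto
  then have "q dvd 2 * int k + 1" using bj dvd_trans by blast
  then obtain m where m: "2 * int k + 1 = m * q" by (metis dvdE mult.commute)
  have q2: "2 \<le> q" using q prime_ge_2_int by blast
  have "odd (2 * int k + 1)" by simp
  then have "odd m" "odd q" unfolding m by auto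
  have "0 < m * q" unfolding m[symmetric] by simp
  then have "0 < m" using q2 by (simp add: zero_less_mult_iff)
  obtain i0 where "m = 2 * i0 + 1" using \<open>odd m\<close> by (elim oddE)
  then have "0 \<le> i0" "m = 2 * i0 + 1" using \<open>0 < m\<close> by auto
  then obtain i where i: "m = 2 * int i + 1" using nonneg_int_cases by metis
  obtain l0 where "q = 2 * l0 + 1" using \<open>odd q\<close> by (elim oddE)
  then have "0 \<le> l0" "q = 2 * l0 + 1" using q2 by auto
  then obtain l where l: "q = 2 * int l + 1" using nonneg_int_cases by metis
  have l1: "1 \<le> l" using l q2 by linarith
  define r where "r = re_quot M T i"
  define M' where "M' = M * r\<^sup>2"
  define T' where "T' = T ^ (2 * i + 1)"
  define W where "W = re_quot M' T' l"
  have "int (2 * k + 1) = int ((2 * i + 1) * (2 * l + 1))" using m unfolding i l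
    by (simp only: of_nat_add of_nat_mult of_nat_1 of_nat_numeral)
  then have k: "2 * k + 1 = (2 * i + 1) * (2 * l + 1)" by (simp only: of_nat_eq_iff)
  have rW: "re_quot M T k = r * W" and imm: "im_quot M T k = im_quot M T i * im_quot M' T' l"
    unfolding r_def W_def M'_def T'_def by (rule quot_mult[OF M k])+
  have im1: "\<bar>im_quot M T i\<bar> = 1" "\<bar>im_quot M' T' l\<bar> = 1"
    using im abs_zmult_eq_1[of "im_quot M T i" "im_quot M' T' l"]
      abs_zmult_eq_1[of "im_quot M' T' l" "im_quot M T i"] unfolding imm
    by (simp_all only: mult.commute)
  then have im2: "(im_quot M T i)\<^sup>2 = 1" "(im_quot M' T' l)\<^sup>2 = 1"
    using power2_abs[of "im_quot M T i"] power2_abs[of "im_quot M' T' l"] by simp_all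
  have norm: "M' + (4 * T - M) = 4 * T'"
    using quot_norm[OF M, of i] unfolding im2 by (simp add: M'_def T'_def r_def)
  have rWb: "\<bar>r\<bar> * \<bar>W\<bar> = b ^ d" using re rW by (simp add: abs_mult)
  have "b ^ d \<noteq> 0" using b by simp
  then have nz: "r \<noteq> 0" "W \<noteq> 0" using rWb by auto
  then have M'0: "0 < M'" using M by (simp add: M'_def)
  have M'T': "M' < 4 * T'" using norm M by linarith
  have "T \<le> T'" unfolding T'_def using T by (intro self_le_power) auto
  then have T'2: "2 \<le> T'" using T by linarith
  have normW: "M' * W\<^sup>2 + (4 * T' - M') = 4 * T' ^ (2 * l + 1)"
    using quot_norm[OF M'0 M'T', of l] unfolding im2 by (simp add: W_def)
  have bT': "coprime b T'" using bT by (simp add: T'_def)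
  have "r dvd b ^ d" "W dvd b ^ d" unfolding rWb[symmetric] by simp_all
  then have rT: "coprime r T'" using bT' by (meson coprime_divisors coprime_power_left_iff dvd_refl)
  have MT': "coprime M T'" using b by (simp add: T'_def)
  have M'cop: "coprime M' T'" using rT MT' by (simp add: M'_def)
  have "q dvd M'" using q b by (auto simp: M'_def intro: dvd_trans)
  \<comment> \<open>A prime divisor of \<open>W\<close> divides \<open>b\<close>, hence \<open>M'\<close>, and \<open>W\<close> is \<open>q\<close> times a unit modulo \<open>M'\<close>.\<close>
  have "\<exists>t. \<bar>W\<bar> = q ^ t"
  proof (rule all_prime_divisors_eq_imp_power[OF q(1) nz(2)])
    fix x :: int assume x: "prime x" "x dvd W"
    then have "x dvd b" using \<open>W dvd b ^ d\<close> prime_dvd_power dvd_trans by blast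
    then have "x dvd M'" using b by (auto simp: M'_def intro: dvd_trans)
    then have "x dvd W - (- T') ^ l * (2 * int l + 1)"
      using re_quot_mod[of M' T' l] by (auto simp: cong_iff_dvd_diff W_def intro: dvd_trans)
    then have "x dvd (- T') ^ l * q" using x by (metis dvd_diff_right_iff l)
    moreover have "\<not> x dvd T'" using bT' \<open>x dvd b\<close> x not_coprimeI not_prime_unit by blast
    then have "\<not> x dvd (- T') ^ l" using x prime_dvd_power dvd_minus_iff by blast
    ultimately have "x dvd q" using x prime_dvd_mult_iff by blast
    then show "x = q" using x q primes_dvd_imp_eq by blast
  qed
  then obtain t where t: "\<bar>W\<bar> = q ^ t" by blast
  show ?thesis
  proof (cases "q = 3 \<and> \<not> 9 dvd M'")
    case True
    then have "l = 1" using l by simp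
    define e where "e = M' - T'"
    have e: "e = 1 \<or> e = -1" using im1(2) \<open>l = 1\<close> unfolding e_def by auto
    have "W = e - 2 * T'" unfolding W_def e_def \<open>l = 1\<close> by simp
    then have "2 * T' = 3 ^ t + e" using t True T'2 e by auto
    moreover have "\<bar>r\<bar> * 3 ^ t = b ^ d" using rWb t True by simp
    ultimately show ?thesis
      using that(2)[of r i e t] norm e True q unfolding e_def M'_def T'_def by simp
  next
    case False
    have "q \<noteq> 2" using l by presburger
    moreover have "\<not> prime (4 :: int)" using primes_dvd_imp_eq[of 2 "4 :: int"] by auto
    ultimately have q35: "q = 3 \<or> 5 \<le> q" using q q2 by (cases "q = 4") auto
    then have "5 \<le> q \<or> 9 dvd M'" using False by auto
    then have nd: "\<not> q\<^sup>2 dvd W" unfolding W_def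
      using primitive_prime_quotient[OF q(1) l \<open>q dvd M'\<close> M'cop] by blast
    have "t \<le> 1"
    proof (rule ccontr)
      assume "\<not> t \<le> 1"
      then have "q\<^sup>2 dvd \<bar>W\<bar>" unfolding t by (intro le_imp_power_dvd) simp
      then show False using nd by simp
    qed
    then have "\<bar>W\<bar> \<le> q ^ 1" unfolding t using q2 by (intro power_increasing) auto
    then have bound: "T' ^ (2 * l) \<le> int (2 * l + 1) ^ 2"
      using power_cofactor_bound[OF M'0 M'T' normW _ l l1] by simp
    consider "l = 1" | "l = 2" "T' = 2" | "3 \<le> l" "T' = 2" | "2 \<le> l" "3 \<le> T'"
      using l1 T'2 by linarith
    then show ?thesis
    proof cases
      case 1
      then have "T' * T' \<le> 9" using bound by (simp add: power2_eq_square)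
      \<comment> \<open>Only \<open>M' = 9\<close>, \<open>T' = 3\<close> would be small enough, but \<open>M'\<close> and \<open>T'\<close> are coprime.\<close>
      have "T' \<le> 3"
      proof (rule ccontr)
        assume "\<not> T' \<le> 3"
        then have "4 * 4 \<le> T' * T'" by (intro mult_mono) auto
        then show False using \<open>T' * T' \<le> 9\<close> by simp
      qed
      moreover have q3: "q = 3" using l 1 by simp
      then have "9 dvd M'" using False by simp
      then have "9 \<le> M'" using M'0 zdvd_imp_le by blast
      ultimately have "T' = 3" using M'T' T'2 by linarith
      then have "q dvd T'" "q dvd b" using q3 q by auto
      then show ?thesis using bT' q(1) not_coprimeI not_prime_unit by blast
    next
      case 2
      then have "q = 5" using l by simp
      then obtain z where "M' = 5 * z" using \<open>q dvd M'\<close> by blast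
      then have "M' = 5" using M'0 M'T' 2 by simp
      then show ?thesis using that(1)[of r i] norm 2 by (simp add: M'_def T'_def)
    next
      case 3
      then show ?thesis using bound square_le_exp2[of "2 * l"] by simp
    next
      case 4
      have "3 ^ (2 * l) \<le> T' ^ (2 * l)" using 4 by (intro power_mono) auto
      then show ?thesis using bound square_le_exp3[of "2 * l"] 4 by linarith
    qed
  qed
qed

section \<open>Two solutions with positive exponents of the same parity\<close>

text \<open>
  The powers of \<open>3\<close> have period \<open>4\<close> modulo \<open>80 = 16 * 5\<close>. There, a power of \<open>3\<close> is
  \<open>\<plusminus>1\<close> modulo \<open>16\<close> only if it is \<open>1\<close> modulo \<open>80\<close>, so the factor \<open>5\<close> rules out powers of \<open>2\<close> from \<open>16\<close> on.
\<close>
lemma power_of_2_near_power_of_3: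
  fixes e :: int
  assumes eq: "2 ^ n = 3 ^ t + e" and e: "e = 1 \<or> e = -1" and n: "2 \<le> n"
  shows "n = 2 \<and> e = 1 \<or> n = 3 \<and> e = -1"
proof -
  have t: "(3::int) ^ t mod 80 \<in> {1, 3, 9, 27}"
  proof (induction t)
    case (Suc t)
    then have "(3::int) * (3 ^ t mod 80) mod 80 \<in> {1, 3, 9, 27}" by auto
    then show ?case by (simp add: mod_mult_right_eq)
  qed simp
  have small: "(3::int) ^ t \<notin> {5, 7}"
  proof
    assume "(3::int) ^ t \<in> {5, 7}"
    then show False using t by auto
  qed
  have "n < 4"
  proof (rule ccontr)
    assume "\<not> n < 4"
    then have "(2::int) ^ 4 dvd 2 ^ n" by (intro le_imp_power_dvd) simp
    then have "16 dvd (3::int) ^ t + e" unfolding eq by simp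
    then have "(3 ^ t + e) mod 80 = 0" using t e by (auto; presburger)
    then have "80 dvd (2::int) ^ n" unfolding eq by presburger
    then have "5 dvd (2::int) ^ n" by (rule dvd_trans[rotated]) simp
    moreover have "prime (5::int)" by simp
    ultimately have "5 dvd (2::int)" using prime_dvd_power by blast
    then show False by simp
  qed
  then have "n = 2 \<or> n = 3" using n by auto
  then show ?thesis using eq e small by auto
qed

lemma power_eq_prime:
  fixes b q :: int
  assumes "prime q" "b ^ y = q" "1 < b" shows "b = q \<and> y = 1"
proof -
  have "y \<noteq> 0" using assms by (metis not_prime_1 power_0)
  then have "b dvd q" using assms by (metis dvd_power gr0I)
  then have b: "b = q" using assms by (metis prime_int_iff less_imp_le order_trans zero_le_one less_irrefl)
  have "1 < q" using assms b by simp
  moreover have "q ^ y = q ^ 1" using assms b by simp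
  ultimately show ?thesis using b power_inject_exp by blast
qed

lemma prime_power_cancel_cofactor:
  fixes q x y :: int
  assumes q: "prime q" and xy: "\<not> q dvd x" "\<not> q dvd y" and eq: "x * q ^ t = q ^ d * y"
  shows "t = d \<and> x = y"
proof -
  have q0: "q \<noteq> 0" using q by auto
  consider "t < d" | "d < t" | "t = d" by linarith
  then show ?thesis
  proof cases
    case 1
    then have "q ^ d = q ^ t * q ^ (d - t)" by (simp flip: power_add)
    then have "x = q ^ (d - t) * y" using eq q0 by simp
    then show ?thesis using xy 1 by (simp add: dvd_power)
  next
    case 2
    then have "q ^ t = q ^ d * q ^ (t - d)" by (simp flip: power_add)
    then have "y = q ^ (t - d) * x" using eq q0 by (auto simp: mult.commute)
    then show ?thesis using xy 2 by (simp add: dvd_power)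
  qed (use eq q0 in simp)
qed

lemma same_parity_solutions:
  fixes p b c :: int
  assumes p: "prime p" and b: "1 < b" "\<not> p dvd b" and c: "2 \<le> c" and y: "1 \<le> y" "1 \<le> d"
    and s1: "p ^ x1 = b ^ y + c" and s2: "p ^ x2 = b ^ (y + 2 * d) + c"
  shows "y = 1 \<and> (p, b, c) \<in> {(13, 3, 10), (2, 5, 3), (2, 3, 5), (2, 3, 13)}"
proof -
  define A where "A = b ^ y"
  have p1: "1 < p" using p prime_gt_1_int by blast
  have "b \<le> A" unfolding A_def using b y by (intro self_le_power) auto
  then have A2: "2 \<le> A" using b by linarith
  have bA: "b dvd A" unfolding A_def using y by (simp add: dvd_power)
  have pA: "\<not> p dvd A" unfolding A_def using p b prime_dvd_power by blast
  have "b ^ y < b ^ (y + 2 * d)" using b y by (intro power_strict_increasing) auto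
  then have "p ^ x1 < p ^ x2" using s1 s2 by simp
  then have x12: "x1 < x2" using p1 power_less_imp_less_exp by blast
  have "x1 \<noteq> 0" using s1 c A2 unfolding A_def by (intro notI) simp
  then have "p dvd A + c" unfolding A_def s1[symmetric] by (simp add: dvd_power)
  then have pc: "\<not> p dvd c" using pA by (metis dvd_add_left_iff)
  \<comment> \<open>For \<open>p = 2\<close> both \<open>b^y\<close> and \<open>c\<close> are odd and at least \<open>3\<close>, so the norm \<open>4\<close> of the
      denominator can be taken out.\<close>
  have "\<exists>(D::int) (E::int) h n. (p \<noteq> 2 \<and> D = 1 \<and> E = 2 \<or> p = 2 \<and> D = 2 \<and> E = 1 \<and> 2 \<le> A) \<and>
      1 \<le> h \<and> h \<le> n \<and> A + c = D\<^sup>2 * p ^ h \<and> p ^ x2 = D\<^sup>2 * p ^ n"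
  proof (cases "p = 2")
    case False
    then show ?thesis using s1 \<open>x1 \<noteq> 0\<close> x12
      by (intro exI[of _ 1] exI[of _ 2] exI[of _ x1] exI[of _ x2]) (auto simp: A_def)
  next
    case True
    have "odd A" "odd c" using True pA pc by auto
    then have "A \<noteq> 2" "c \<noteq> 2" by auto
    then have "(2::int) ^ 2 < 2 ^ x1" using A2 c s1 True by (simp add: A_def)
    then have "2 < x1" by (metis power_less_imp_less_exp one_less_numeral_iff semiring_norm(76))
    have "2 ^ x = 2\<^sup>2 * (2::int) ^ (x - 2)" if "2 < x" for x
      using that by (metis le_add_diff_inverse less_imp_le power_add)
    then have "2 ^ x1 = 2\<^sup>2 * (2::int) ^ (x1 - 2)" "2 ^ x2 = 2\<^sup>2 * (2::int) ^ (x2 - 2)"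
      using x12 \<open>2 < x1\<close> by auto
    then show ?thesis using s1 True A2 \<open>2 < x1\<close> x12
      by (intro exI[of _ 2] exI[of _ 1] exI[of _ "x1 - 2"] exI[of _ "x2 - 2"]) (auto simp: A_def)
  qed
  then obtain D E :: int and h n where DE: "p \<noteq> 2 \<and> D = 1 \<and> E = 2 \<or> p = 2 \<and> D = 2 \<and> E = 1 \<and> 2 \<le> A"
    and hn: "1 \<le> h" "h \<le> n" and Ac: "A + c = D\<^sup>2 * p ^ h" and n: "p ^ x2 = D\<^sup>2 * p ^ n"
    by blast
  interpret norm_form p A c D E h
    using p A2 c pA pc DE hn Ac by unfold_locales auto
  define X where "X = b ^ d"
  have "A * X\<^sup>2 = b ^ (y + 2 * d)" by (simp add: A_def X_def power_add power_mult mult.commute)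
  then have N: "A * X\<^sup>2 + c * Y\<^sup>2 = D\<^sup>2 * p ^ n" if "Y = 1 \<or> Y = -1" for Y
    using that s2 n by auto
  have pX: "\<not> p dvd X" unfolding X_def using p b prime_dvd_power by blast
  \<comment> \<open>The sign of \<open>Y\<close> selects the conjugate that is divisible by \<open>\<alpha>\<close>.\<close>
  have "D * p ^ h dvd 1 - X \<or> D * p ^ h dvd 1 + X"
    using prime_power_dvd_difference_or_sum[OF N[of 1] hn(2) pX] by simp
  moreover have "D * p ^ h dvd -1 - X \<longleftrightarrow> D * p ^ h dvd 1 + X"
    using dvd_minus_iff[of "D * p ^ h" "1 + X"] by (simp add: algebra_simps)
  ultimately obtain Y where Y: "Y = 1 \<or> Y = -1" "D * p ^ h dvd Y - X" by blast
  obtain j where j: "odd j" "elt X Y = \<alpha> ^ j \<or> elt X Y = - (\<alpha> ^ j)"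
    using descent[OF N[OF Y(1)] hn(2) pX Y(2)] A2 by blast
  then obtain k where k: "j = 2 * k + 1" by (elim oddE)
  \<comment> \<open>The parameters of \<open>\<alpha>\<close>: \<open>M = 4 A / D^2\<close> and \<open>T = p^h\<close>.\<close>
  define M where "M = E\<^sup>2 * A"
  define T where "T = p ^ h"
  have D0: "real_of_int D \<noteq> 0" using D_pos by simp
  have T_M: "4 * T - M = E\<^sup>2 * c" using DE Ac unfolding T_def M_def by auto
  have MD: "D\<^sup>2 * M = 4 * A" using DE unfolding M_def by auto
  have Re: "real_of_int M = (2 * Re \<alpha>)\<^sup>2"
  proof -
    have "(real_of_int D)\<^sup>2 * M = 4 * A" using MD[THEN arg_cong[of _ _ real_of_int]] by simp
    then show ?thesis using D0 A by (simp add: elt_def power_mult_distrib power_divide field_simps)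
  qed
  have norm: "real_of_int T = (Re \<alpha>)\<^sup>2 + (Im \<alpha>)\<^sup>2"
  proof -
    have "(real_of_int D)\<^sup>2 * T = A + c" using Ac[THEN arg_cong[of _ _ real_of_int]] by (simp add: T_def)
    then show ?thesis using D0 A C by (simp add: elt_def power_divide field_simps)
  qed
  have "Re (elt X Y) = X * Re \<alpha>" "Im (elt X Y) = Y * Im \<alpha>" by (simp_all add: elt_def)
  then have "X * Re \<alpha> = re_quot M T k * Re \<alpha> \<or> X * Re \<alpha> = - (re_quot M T k * Re \<alpha>)"
    "Y * Im \<alpha> = im_quot M T k * Im \<alpha> \<or> Y * Im \<alpha> = - (im_quot M T k * Im \<alpha>)"
    using j(2) odd_power_parts[OF Re norm, of k] unfolding k
    by (auto simp: mult.commute)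
  moreover have "Re \<alpha> \<noteq> 0" "Im \<alpha> \<noteq> 0" using D0 A C by (simp_all add: elt_def)
  ultimately have "real_of_int X = re_quot M T k \<or> real_of_int X = real_of_int (- re_quot M T k)"
    "real_of_int Y = im_quot M T k \<or> real_of_int Y = real_of_int (- im_quot M T k)"
    by (simp_all flip: mult_minus_left)
  then have "X = re_quot M T k \<or> X = - re_quot M T k" "Y = im_quot M T k \<or> Y = - im_quot M T k"
    by (simp_all only: of_int_eq_iff)
  moreover have "0 < X" using b by (simp add: X_def)
  ultimately have re: "\<bar>re_quot M T k\<bar> = b ^ d" and im: "\<bar>im_quot M T k\<bar> = 1"
    using Y(1) unfolding X_def[symmetric] by auto
  have "b dvd M" unfolding M_def using bA by simp
  have "p \<le> T" unfolding T_def using p1 h by (intro self_le_power) auto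
  then have T2: "2 \<le> T" using p1 by linarith
  have "\<not> p dvd E"
  proof
    assume "p dvd E"
    then have "p dvd 2" "p \<noteq> 2" using DE p1 by auto
    then show False using p by (metis primes_dvd_imp_eq prime_int_numeral_eq two_is_prime_nat)
  qed
  then have "\<not> p dvd M" unfolding M_def using p pA prime_dvd_mult_iff prime_dvd_power by blast
  then have MT: "coprime M T" unfolding T_def using p prime_imp_coprime coprime_commute by auto
  have M: "0 < M" "M < 4 * T" using T_M DE A2 c by (auto simp: M_def)
  from re_quot_power_cases[OF b(1) \<open>b dvd M\<close> MT T2 M re y(2) im]
  show ?thesis
  proof cases
    case (1 i r)
    then have "5 + E\<^sup>2 * c = 8" using T_M by simp
    moreover have "E = 1 \<or> E = 2" using DE by auto
    moreover have "4 * c \<noteq> 3" by presburger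
    ultimately have E: "E = 1" "c = 3" by auto
    then have Ar: "A * r\<^sup>2 = 5" using 1 by (simp add: M_def)
    then have "A dvd 5" by (metis dvd_triv_left)
    have p5: "prime (5 :: int)" by simp
    have "A = 5" using spec[OF conjunct2[OF prime_int_iff[THEN iffD1, OF p5]], of A] A2 \<open>A dvd 5\<close> by linarith
    moreover note p5
    ultimately have "b = 5 \<and> y = 1" using power_eq_prime b unfolding A_def by blast
    then show ?thesis using E DE by simp
  next
    case (2 i r t e)
    define T' where "T' = T ^ (2 * i + 1)"
    note 2 = 2[folded T'_def]
    \<comment> \<open>Otherwise \<open>9\<close> divides \<open>b^y\<close>.\<close>
    have "y = 1"
    proof (rule ccontr)
      assume "y \<noteq> 1"
      then have "b\<^sup>2 dvd A" unfolding A_def using y by (intro le_imp_power_dvd) simp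
      moreover have "3\<^sup>2 dvd b\<^sup>2" by (rule dvd_power_same[OF 2(7)])
      ultimately have "3\<^sup>2 dvd A" by (rule dvd_trans[rotated])
      then have "9 dvd A" by simp
      then show False using 2(6) by (simp add: M_def)
    qed
    then have Ab: "A = b" by (simp add: A_def)
    show ?thesis
    proof (cases "p = 2")
      case True
      then have E: "E = 1" using DE by simp
      have T': "T' = 2 ^ (h * (2 * i + 1))" by (simp only: T'_def T_def True power_mult)
      then have "2 ^ Suc (h * (2 * i + 1)) = 3 ^ t + e" using 2(4) by simp
      then have "Suc (h * (2 * i + 1)) = 2 \<and> e = 1 \<or> Suc (h * (2 * i + 1)) = 3 \<and> e = -1"
        using power_of_2_near_power_of_3[of "Suc (h * (2 * i + 1))"] 2(3) h by simp
      then have T'e: "T' = 2 \<and> e = 1 \<or> T' = 4 \<and> e = -1" unfolding T' by auto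
      then have "M * r\<^sup>2 = 3" using 2(2) by auto
      then have "b dvd 3" unfolding M_def E Ab by (metis dvd_triv_left mult_1 one_power2)
      then have "b = 3" using 2(7) b by (meson zdvd_antisym_nonneg less_imp_le order_trans zero_le_one zero_le_numeral)
      moreover have "3 + c = 4 * T'" using 2(1) T_M \<open>M * r\<^sup>2 = 3\<close> E by simp
      ultimately show ?thesis using \<open>y = 1\<close> T'e True by auto
    next
      case False
      then have E: "E = 2" using DE by simp
      \<comment> \<open>Here \<open>8 b r^2 = 3^t \<plusminus> 3\<close> although \<open>r\<close> is the full cofactor of \<open>3^t\<close> in a power of \<open>b\<close>.
          Comparing sizes leaves only \<open>b = 3\<close>.\<close>
      have Mr: "4 * b * r\<^sup>2 = T' + e" using 2(2) by (simp add: M_def E Ab)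
      then have eq: "8 * b * r\<^sup>2 = 3 ^ t + 3 * e" using 2(4) by simp
      obtain g where g: "b = 3 * g" using 2(7) by blast
      have "0 < g" using g b by simp
      have prime3: "prime (3::int)" by simp
      have g3: "\<not> 3 dvd g" "\<not> 3 dvd r"
        using 2(6) unfolding M_def E Ab g by (auto simp: power2_eq_square)
      have "\<bar>r\<bar> * 3 ^ t = 3 ^ d * g ^ d" using 2(5) by (simp add: g power_mult_distrib)
      moreover have "\<not> 3 dvd g ^ d" using g3 prime3 prime_dvd_power by blast
      ultimately have td: "t = d" and r: "\<bar>r\<bar> = g ^ d"
        using g3 prime3 prime_power_cancel_cofactor[of 3 "\<bar>r\<bar>" "g ^ d" t d] by auto
      have rsq: "r\<^sup>2 = (g ^ d)\<^sup>2" using r by (metis power2_abs)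
      have "g = 1"
      proof (rule ccontr)
        assume "g \<noteq> 1"
        then have g2: "2 \<le> g" using \<open>0 < g\<close> by simp
        have "(2 ^ d)\<^sup>2 \<le> (g ^ d)\<^sup>2" using g2 by (intro power_mono) auto
        moreover have "(3::int) ^ d \<le> (2\<^sup>2) ^ d" by (intro power_mono) auto
        moreover have "((2::int)\<^sup>2) ^ d = (2 ^ d)\<^sup>2" by (simp only: power_mult[symmetric] mult.commute)
        ultimately have "3 ^ t \<le> r\<^sup>2" unfolding rsq td by linarith
        then have "2 * 3 ^ t \<le> g * r\<^sup>2" using g2 by (intro mult_mono) auto
        moreover have "24 * (g * r\<^sup>2) = 3 ^ t + 3 * e" using eq by (simp add: g)
        moreover have "(1::int) \<le> 3 ^ t" by simp
        ultimately show False using 2(3) by linarith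
      qed
      then have "b = 3" "r\<^sup>2 = 1" using g rsq by auto
      then have "3 ^ t + 3 * e = 24" and T'e: "T' + e = 12" using eq Mr by auto
      have "e \<noteq> 1"
      proof
        assume "e = 1"
        then have t21: "(3::int) ^ t = 21" using \<open>3 ^ t + 3 * e = 24\<close> by simp
        have "t \<noteq> 0" "t \<noteq> 1" using t21 by (intro notI; simp)+
        then have "(3::int)\<^sup>2 dvd 3 ^ t" by (intro le_imp_power_dvd) simp
        then show False using t21 by simp
      qed
      then have "T' = 13" "e = -1" using T'e 2(3) by auto
      then have "p dvd 13" using h by (metis T'_def T_def dvd_power dvd_power_same dvd_trans
          One_nat_def add_gr_0 less_eq_Suc_le zero_less_one)
      moreover have "prime (13 :: int)" by simp
      ultimately have "p = 13" using p primes_dvd_imp_eq by blast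
      moreover have "M * r\<^sup>2 = 12" using \<open>T' = 13\<close> 2(2) \<open>e = -1\<close> by simp
      then have "c = 10" using 2(1) T_M E \<open>T' = 13\<close> by simp
      ultimately show ?thesis using \<open>b = 3\<close> \<open>y = 1\<close> by simp
    qed
  qed
qed

section \<open>Two powers that are one larger than powers of the same number\<close>

definition repunit :: "int \<Rightarrow> nat \<Rightarrow> int" where
  "repunit P n = (\<Sum>i<n. P ^ i)"

lemma repunit_simps [simp]: "repunit P 0 = 0" "repunit P (Suc n) = repunit P n + P ^ n"
  by (simp_all add: repunit_def)

lemma repunit_eq: "(P - 1) * repunit P n = P ^ n - 1"
  by (induction n) (auto simp: algebra_simps)

lemma repunit_mod: "P - 1 dvd repunit P n - int n"
proof (induction n)
  case (Suc n)
  have "P - 1 dvd P ^ n - 1" by (simp flip: repunit_eq)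
  then have "P - 1 dvd (repunit P n - int n) + (P ^ n - 1)" using Suc by (rule dvd_add[rotated])
  then show ?case by (simp add: algebra_simps)
qed simp

lemma repunit_mod_square: "(P - 1)\<^sup>2 dvd 2 * repunit P n - int n * (2 + (int n - 1) * (P - 1))"
proof (induction n)
  case (Suc n)
  obtain u where u: "repunit P n - int n = (P - 1) * u" using repunit_mod by blast
  then have "repunit P n = int n + (P - 1) * u" by simp
  then have "P ^ n - 1 = (P - 1) * (int n + (P - 1) * u)" by (simp only: repunit_eq[symmetric])
  then have Pn: "P ^ n = 1 + (P - 1) * int n + (P - 1)\<^sup>2 * u"
    by (simp add: algebra_simps power2_eq_square)
  have eq: "2 * repunit P (Suc n) - int (Suc n) * (2 + (int (Suc n) - 1) * (P - 1))
      = (2 * repunit P n - int n * (2 + (int n - 1) * (P - 1))) + (P - 1)\<^sup>2 * (2 * u)"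
    unfolding repunit_simps Pn by (simp add: algebra_simps)
  show ?case unfolding eq using Suc by (intro dvd_add) auto
qed simp

text \<open>
  Write \<open>P = p^x1 = B + 1\<close> with \<open>B = b^y1\<close>. Then \<open>x2\<close> is a multiple \<open>n x1\<close>, and \<open>(P^n - 1) / (P - 1)\<close> is a
  power of \<open>b\<close> that is \<open>n\<close> modulo \<open>B\<close>, so every prime divisor \<open>l\<close> of \<open>b\<close> divides \<open>n\<close>. Now
  \<open>(P^l - 1) / (P - 1)\<close> divides a power of \<open>b\<close> and is \<open>l\<close> modulo \<open>B\<close>, so it is a power of \<open>l\<close>. An odd \<open>l\<close>
  occurs in it only once, which is too little. Hence \<open>b\<close> is a power of \<open>2\<close>, and so are \<open>P - 1\<close> and \<open>P + 1\<close>.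
\<close>
lemma consecutive_powers:
  fixes p b :: int
  assumes p: "prime p" and b: "1 < b" and y: "1 \<le> y1" "y1 < y2"
    and s: "p ^ x1 = b ^ y1 + 1" "p ^ x2 = b ^ y2 + 1"
  shows "x1 = 1"
proof -
  define B where "B = b ^ y1"
  define P where "P = p ^ x1"
  have p1: "1 < p" using p prime_gt_1_int by blast
  have "b \<le> B" unfolding B_def using b y by (intro self_le_power) auto
  then have B2: "2 \<le> B" using b by linarith
  have PB: "P = B + 1" using s by (simp add: P_def B_def)
  have bB: "b dvd B" unfolding B_def using y by (simp add: dvd_power)
  have y2: "b ^ y2 = B * b ^ (y2 - y1)" using y by (simp add: B_def flip: power_add)
  have x1: "0 < x1" using PB B2 unfolding P_def by (cases x1) auto
  \<comment> \<open>\<open>B\<close> divides \<open>p^r - 1\<close>, which is smaller than \<open>B\<close>.\<close>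
  define r where "r = x2 mod x1"
  define n where "n = x2 div x1"
  have "p ^ x2 = P ^ n * p ^ r"
    unfolding P_def r_def n_def by (simp flip: power_mult power_add)
  moreover have BP: "B dvd P ^ n - 1" using repunit_eq[of P n] PB by (metis add_diff_cancel_right' dvd_triv_left)
  ultimately have "B * b ^ (y2 - y1) = (P ^ n - 1) * p ^ r + (p ^ r - 1)"
    using s y2 by (simp add: algebra_simps)
  then have "B dvd (P ^ n - 1) * p ^ r + (p ^ r - 1)" by (metis dvd_triv_left)
  then have "B dvd p ^ r - 1" using BP by (simp add: dvd_add_right_iff)
  moreover have "p ^ r < P" unfolding P_def r_def using x1 p1 by (intro power_strict_increasing) auto
  moreover have "1 \<le> p ^ r" using p1 by simp
  ultimately have "p ^ r = 1" using PB zdvd_imp_le[of B "p ^ r - 1"] by linarith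
  then have "B * repunit P n = B * b ^ (y2 - y1)"
    using \<open>p ^ x2 = P ^ n * p ^ r\<close> s y2 repunit_eq[of P n] PB by simp
  then have repunit: "repunit P n = b ^ (y2 - y1)" using B2 by simp
  have b_dvd_rep: "b dvd repunit P n" unfolding repunit using y by (simp add: dvd_power)
  have rep_mod_B: "B dvd repunit P m - int m" for m using repunit_mod[of P m] PB by simp
  have bn: "b dvd int n"
    using dvd_trans[OF bB rep_mod_B[of n]] b_dvd_rep by (metis dvd_diff_right_iff)
  have G3: "int m < repunit P m" if "2 \<le> m" for m
    using that
  proof (induction m rule: nat_induct_at_least)
    case base
    then show ?case using PB B2 by (simp add: numeral_2_eq_2)
  next
    case (Suc m)
    have "1 \<le> P ^ m" using PB B2 by simp
    then show ?case using Suc by simp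
  qed
  have supp: "\<exists>u. repunit P l = int l ^ u" if l: "prime (int l)" "int l dvd b" for l
  proof -
    have "l dvd n" using bn l(2) dvd_trans int_dvd_int_iff by blast
    then obtain m where m: "n = l * m" by blast
    have "P ^ n - 1 = (P ^ l - 1) * repunit (P ^ l) m" using repunit_eq[of "P ^ l" m] by (simp add: m power_mult)
    then have "B * repunit P n = B * (repunit P l * repunit (P ^ l) m)"
      using repunit_eq[of P n] repunit_eq[of P l] PB by (simp add: mult.assoc)
    then have d: "repunit P l dvd b ^ (y2 - y1)" using B2 repunit by simp
    have "0 < repunit P l" using G3[of l] prime_ge_2_int[OF l(1)] by simp
    moreover have "\<exists>u. \<bar>repunit P l\<bar> = int l ^ u"
    proof (rule all_prime_divisors_eq_imp_power[OF l(1)])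
      fix x :: int assume x: "prime x" "x dvd repunit P l"
      then have "x dvd b" using d prime_dvd_power dvd_trans by blast
      then have "x dvd repunit P l - int l" using bB rep_mod_B[of l] dvd_trans by blast
      then have "x dvd int l" using x by (metis dvd_diff_right_iff)
      then show "x = int l" using x l primes_dvd_imp_eq by blast
    qed (use \<open>0 < repunit P l\<close> in auto)
    ultimately show ?thesis by simp
  qed
  have only2: "x = 2" if x: "prime x" "x dvd b" for x :: int
  proof (rule ccontr)
    assume "x \<noteq> 2"
    obtain l where l: "x = int l" using x prime_ge_0_int zero_le_imp_eq_int by blast
    have l3: "3 \<le> l" using prime_ge_2_int[OF x(1)] \<open>x \<noteq> 2\<close> l by simp
    obtain u where u: "repunit P l = int l ^ u" using supp x l by blast
    have "1 < u"
    proof (rule ccontr)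
      assume "\<not> 1 < u"
      then have "int l ^ u \<le> int l ^ 1" using l3 by (intro power_increasing) auto
      then show False using G3[of l] l3 u by simp
    qed
    have "odd l" using x l l3 by (metis \<open>x \<noteq> 2\<close> even_of_nat primes_dvd_imp_eq two_is_prime_nat prime_int_numeral_eq)
    then have "even (int l - 1)" by simp
    then obtain h where h: "int l - 1 = 2 * h" by blast
    have lB: "int l dvd B" using x l bB dvd_trans by blast
    have "(int l)\<^sup>2 dvd B\<^sup>2" using lB by simp
    then have "(int l)\<^sup>2 dvd 2 * repunit P l - int l * (2 + (int l - 1) * B)"
      using repunit_mod_square[of P l] PB by (metis add_diff_cancel_right' dvd_trans)
    moreover have "(int l)\<^sup>2 dvd 2 * repunit P l" unfolding u using \<open>1 < u\<close> by (intro dvd_mult le_imp_power_dvd) simp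
    ultimately have "(int l)\<^sup>2 dvd int l * (2 + (int l - 1) * B)" by (metis dvd_diff_right_iff)
    then have "int l dvd 2 + (int l - 1) * B" using l3 by (simp add: power2_eq_square)
    then have "int l dvd 2" using lB by (simp add: dvd_add_left_iff)
    then show False using zdvd_imp_le[of "int l" 2] l3 by simp
  qed
  have b0: "b \<noteq> 0" using b by simp
  obtain v where v: "b = 2 ^ v"
    using all_prime_divisors_eq_imp_power[OF _ b0 only2] b by auto
  then have "v \<noteq> 0" using b by (metis less_irrefl power_0)
  then have "2 dvd b" using v by simp
  then obtain u where "repunit P 2 = int 2 ^ u" using supp[of 2] by auto
  then have u: "B + 2 = 2 ^ u" using PB by (simp add: numeral_2_eq_2)
  have B: "B = 2 ^ (v * y1)" by (simp add: B_def v power_mult)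
  have "B = 2"
  proof (rule ccontr)
    assume "B \<noteq> 2"
    then have "v * y1 \<noteq> 1" using B by auto
    moreover have "v * y1 \<noteq> 0" using \<open>v \<noteq> 0\<close> y by simp
    ultimately have "(2::int)\<^sup>2 dvd B" unfolding B by (intro le_imp_power_dvd) linarith
    moreover have "(2::int)\<^sup>2 dvd 2 ^ u"
    proof (rule le_imp_power_dvd, rule ccontr)
      assume "\<not> 2 \<le> u"
      then have "u = 0 \<or> u = 1" by linarith
      then show False using u B2 by auto
    qed
    ultimately have "4 dvd B + 2" "4 dvd B" using u by simp_all
    then show False by presburger
  qed
  then have p3: "p ^ x1 = 3" using PB by (simp add: P_def)
  then have "p dvd 3" using x1 by (metis dvd_power)
  then have "p = 3" using p primes_dvd_imp_eq[of p 3] by simp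
  then have "(3::int) ^ x1 = 3 ^ 1" using p3 by simp
  then show ?thesis by (simp only: power_inject_exp)
qed

section \<open>Powers of one plus a square root\<close>

text \<open>
  The coordinates of \<open>(1 + \<surd>(-c))^n\<close> with respect to \<open>1\<close> and \<open>\<surd>(-c)\<close>.
\<close>
fun re_pow :: "int \<Rightarrow> nat \<Rightarrow> int" and im_pow :: "int \<Rightarrow> nat \<Rightarrow> int" where
  "re_pow c 0 = 1" | "re_pow c (Suc n) = re_pow c n - c * im_pow c n"
| "im_pow c 0 = 0" | "im_pow c (Suc n) = re_pow c n + im_pow c n"

lemma pow_parts:
  assumes "0 \<le> c"
  shows "Complex 1 (sqrt (real_of_int c)) ^ n = Complex (re_pow c n) (im_pow c n * sqrt c)"
proof (induction n)
  case (Suc n)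
  have "\<bar>real_of_int c\<bar> = real_of_int c" using assms by simp
  then show ?case by (simp add: Suc complex_eq_iff algebra_simps)
qed (simp add: complex_eq_iff)

lemma pow_add:
  "re_pow c (m + n) = re_pow c m * re_pow c n - c * im_pow c m * im_pow c n \<and>
   im_pow c (m + n) = re_pow c m * im_pow c n + im_pow c m * re_pow c n"
proof (induction m)
  case (Suc m)
  then show ?case by (simp add: algebra_simps)
qed simp

lemmas re_pow_add = pow_add[THEN conjunct1] and im_pow_add = pow_add[THEN conjunct2]

lemma im_pow_even: "even (im_pow c (2 * n))"
  unfolding mult_2 im_pow_add by (simp add: mult.commute)

text \<open>
  \<open>2\<close>-adically, \<open>(1 + \<surd>(-c))^(2^e m)\<close> is close to \<open>1 + 2^e m \<surd>(-c)\<close>. For \<open>m = 1\<close> the proof is by repeated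
  squaring, starting from the fourth power.
\<close>
lemma two_adic_powers:
  assumes c: "even c" and e: "2 \<le> e"
  shows "2 ^ Suc e dvd re_pow c (2 ^ e * m) - 1 \<and> 2 ^ Suc e dvd im_pow c (2 ^ e * m) - 2 ^ e * int m"
proof -
  have base: "2 ^ Suc e dvd re_pow c (2 ^ e) - 1 \<and> 2 ^ Suc e dvd im_pow c (2 ^ e) - 2 ^ e"
    using e
  proof (induction e rule: nat_induct_at_least)
    case base
    obtain a where a: "c = 2 * a" using c by blast
    have "re_pow c 4 = 1 - 6 * c + c\<^sup>2" "im_pow c 4 = 4 * (1 - c)"
      by (simp_all add: eval_nat_numeral algebra_simps)
    then have "re_pow c 4 - 1 = 4 * (a * (a - 3))" "im_pow c 4 - 4 = 8 * (- a)"
      by (simp_all add: a power2_eq_square algebra_simps)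
    moreover have "even (a * (a - 3))" by simp
    then obtain g where "a * (a - 3) = 2 * g" by blast
    ultimately have "re_pow c 4 - 1 = 8 * g" "im_pow c 4 - 4 = 8 * (- a)" by simp_all
    then show ?case by simp
  next
    case (Suc e)
    then obtain u v where u: "re_pow c (2 ^ e) - 1 = 2 ^ Suc e * u" and v: "im_pow c (2 ^ e) - 2 ^ e = 2 ^ Suc e * v"
      by blast
    have u': "re_pow c (2 ^ e) = 1 + 2 * 2 ^ e * u" and v': "im_pow c (2 ^ e) = 2 ^ e + 2 * 2 ^ e * v"
      using u v by simp_all
    obtain g where g: "(2::int) ^ e = 4 * g"
      using Suc.hyps le_imp_power_dvd[of 2 e "2::int"] by auto
    obtain a where a: "c = 2 * a" using c by blast
    define K where "K = (2::int) ^ e"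
    have "(1 + 2 * K * u) * (1 + 2 * K * u) - c * (K + 2 * K * v) * (K + 2 * K * v) - 1
        = 2 * (2 * K) * (u + K * u\<^sup>2) - 2 * a * K * (1 + 2 * v)\<^sup>2 * K"
      by (simp add: a algebra_simps power2_eq_square)
    also have "\<dots> = 2 * (2 * K) * (u + K * u\<^sup>2) - 2 * a * K * (1 + 2 * v)\<^sup>2 * (4 * g)"
      unfolding K_def by (subst (4) g) (rule refl)
    also have "\<dots> = 2 * (2 * K) * (u + K * u\<^sup>2 - 2 * a * g * (1 + 2 * v)\<^sup>2)"
      by (simp add: algebra_simps)
    finally have "re_pow c (2 ^ Suc e) - 1 = 2 ^ Suc (Suc e) * (u + 2 ^ e * u\<^sup>2 - 2 * a * g * (1 + 2 * v)\<^sup>2)"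
      unfolding K_def power_Suc mult_2[of "2 ^ e"] re_pow_add u' v' by (simp only: mult_2 power_Suc)
    moreover have "im_pow c (2 ^ Suc e) - 2 ^ Suc e = 2 ^ Suc (Suc e) * (v + 2 ^ e * u * (1 + 2 * v))"
      unfolding power_Suc mult_2 im_pow_add u' v'
      by (simp add: algebra_simps power2_eq_square)
    ultimately show ?case by simp
  qed
  then obtain u v where u: "re_pow c (2 ^ e) - 1 = 2 ^ Suc e * u" and v: "im_pow c (2 ^ e) - 2 ^ e = 2 ^ Suc e * v"
    by blast
  have u': "re_pow c (2 ^ e) = 1 + 2 * 2 ^ e * u" and v': "im_pow c (2 ^ e) = 2 ^ e + 2 * 2 ^ e * v"
    using u v by simp_all
  obtain a where a: "c = 2 * a" using c by blast
  show ?thesis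
  proof (induction m)
    case (Suc m)
    then obtain x y where "re_pow c (2 ^ e * m) - 1 = 2 ^ Suc e * x" "im_pow c (2 ^ e * m) - 2 ^ e * int m = 2 ^ Suc e * y"
      by blast
    then have x: "re_pow c (2 ^ e * m) = 1 + 2 * 2 ^ e * x" and y: "im_pow c (2 ^ e * m) = 2 ^ e * int m + 2 * 2 ^ e * y"
      by simp_all
    have "re_pow c (2 ^ e * Suc m) - 1
        = 2 ^ Suc e * (x + u + 2 * 2 ^ e * u * x - a * 2 ^ e * (1 + 2 * v) * (int m + 2 * y))"
      unfolding mult_Suc_right re_pow_add u' v' x y
      by (simp add: a algebra_simps power2_eq_square)
    moreover have "im_pow c (2 ^ e * Suc m) - 2 ^ e * int (Suc m)
        = 2 ^ Suc e * (y + v + 2 ^ e * u * (int m + 2 * y) + 2 ^ e * x * (1 + 2 * v))"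
      unfolding mult_Suc_right im_pow_add u' v' x y
      by (simp add: algebra_simps power2_eq_square)
    ultimately show ?case by simp
  qed simp
qed

text \<open>
  An even \<open>j\<close> makes the imaginary part even. For \<open>j - 1 = 2^e m\<close> with \<open>m\<close> odd and \<open>e \<ge> 2\<close>, the
  imaginary part is \<open>1 + 2^e\<close> modulo \<open>2^(e+1)\<close> and hence not \<open>\<plusminus>1\<close>. So \<open>j \<equiv> 3\<close> modulo \<open>4\<close>, and
  the power is close to the cube \<open>1 - 3 c + (3 - c) \<surd>(-c)\<close>.
\<close>
lemma im_pow_unit:
  assumes c: "even c" and j: "1 < j" and im: "im_pow c j = s" "s = 1 \<or> s = -1"
  shows "8 dvd re_pow c j - (1 - 3 * c) \<and> 4 dvd s - (3 - c)"
proof -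
  have "odd j"
  proof
    assume "even j"
    then obtain n where "j = 2 * n" by blast
    then show False using im_pow_even[of c n] im by auto
  qed
  have "j mod 4 \<noteq> 1"
  proof
    assume j4: "j mod 4 = 1"
    obtain m where m: "j - 1 = 2 ^ multiplicity 2 (j - 1) * m" "odd m"
      by (rule multiplicity_decompose'[of "j - 1" 2]) (use j in auto)
    define e where "e = multiplicity 2 (j - 1)"
    have em: "j - 1 = 2 ^ e * m" unfolding e_def by (rule m(1))
    have "4 dvd j - 1" using j4 j by presburger
    have e: "2 \<le> e"
    proof (rule ccontr)
      assume "\<not> 2 \<le> e"
      then have "e = 0 \<or> e = 1" by linarith
      then have "j - 1 = m \<or> j - 1 = 2 * m" using em by auto
      then show False using m(2) \<open>4 dvd j - 1\<close> by presburger
    qed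
    have "im_pow c j = im_pow c (Suc (j - 1))" using j by simp
    then have s: "s = re_pow c (2 ^ e * m) + im_pow c (2 ^ e * m)" unfolding em im(1) by simp
    obtain x y where "re_pow c (2 ^ e * m) - 1 = 2 ^ Suc e * x" "im_pow c (2 ^ e * m) - 2 ^ e * int m = 2 ^ Suc e * y"
      using two_adic_powers[OF c e, of m] by blast
    then have s1: "s = 1 + 2 ^ e * (int m + 2 * (x + y))" using s by (simp add: algebra_simps)
    obtain g where g: "(2::int) ^ e = 4 * g" using e le_imp_power_dvd[of 2 e "2::int"] by auto
    show False using im(2)
    proof
      assume "s = 1"
      then have "int m + 2 * (x + y) = 0" using s1 by simp
      then show False using m(2) by presburger
    next
      assume "s = -1"
      then have "4 * (g * (int m + 2 * (x + y))) = -2" using s1 g by simp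
      then show False by presburger
    qed
  qed
  then have "j mod 4 = 3" using \<open>odd j\<close> by presburger
  then have "j = 4 * (j div 4) + 3" by presburger
  then obtain n where "j = 4 * n + 3" by blast
  then have j4: "j = 2\<^sup>2 * n + 3" by simp
  obtain x y where "re_pow c (2\<^sup>2 * n) - 1 = 2 ^ Suc 2 * x" "im_pow c (2\<^sup>2 * n) - 2\<^sup>2 * int n = 2 ^ Suc 2 * y"
    using two_adic_powers[OF c order_refl, of n] by (elim conjE dvdE)
  then have x: "re_pow c (2\<^sup>2 * n) = 1 + 8 * x" and y: "im_pow c (2\<^sup>2 * n) = 4 * (int n + 2 * y)"
    by simp_all
  obtain a where a: "c = 2 * a" using c by blast
  have 3: "re_pow c 3 = 1 - 3 * c" "im_pow c 3 = 3 - c" by (simp_all add: eval_nat_numeral algebra_simps)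
  have "re_pow c j - (1 - 3 * c) = 8 * (x * (1 - 3 * c) - a * (int n + 2 * y) * (3 - c))"
    unfolding j4 re_pow_add x y 3 by (simp add: a algebra_simps)
  moreover have "im_pow c j - (3 - c) = 4 * (2 * x * (3 - c) + (int n + 2 * y) * (1 - 3 * c))"
    unfolding j4 im_pow_add x y 3 by (simp add: algebra_simps)
  ultimately show ?thesis unfolding im(1)[symmetric] by (intro conjI dvdI)
qed

section \<open>A zero, an even and an odd exponent\<close>

lemma odd_power_mod_8:
  fixes b :: int
  assumes "odd b" shows "b ^ n mod 8 = (if odd n then b mod 8 else 1)"
proof (induction n)
  case (Suc n)
  have "b mod 8 = 1 \<or> b mod 8 = 3 \<or> b mod 8 = 5 \<or> b mod 8 = 7" using assms by presburger
  moreover have "b ^ Suc n mod 8 = (b mod 8) * (b ^ n mod 8) mod 8" by (simp add: mod_mult_eq)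
  ultimately show ?case using Suc by (auto split: if_splits)
qed simp

text \<open>
  The odd exponent has two uses. It shows \<open>b^m \<equiv> 1\<close> modulo \<open>p^x1\<close>, since the square and an odd power of \<open>b^m\<close> are
  \<open>1\<close>; this fixes the sign in \<open>b^m + \<surd>(-c) = \<plusminus>(1 + \<surd>(-c))^j\<close>. And it gives the congruence that contradicts the values of
  \<open>b\<close> and \<open>c\<close> modulo \<open>8\<close> found from the even exponent, unless \<open>p^x2\<close> is a square, and then it is too far from the square \<open>b^(2m)\<close>.
\<close>
lemma no_even_and_odd_exponent_odd_prime:
  fixes p b c :: int
  assumes p: "prime p" "p \<noteq> 2" and b: "1 < b" and c: "0 < c"
    and s1: "p ^ x1 = 1 + c" and s2: "p ^ x2 = b ^ (2 * m) + c" "1 \<le> m"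
    and s3: "p ^ x3 = b ^ y3 + c" "odd y3"
  shows False
proof -
  have p3: "3 \<le> p" using p prime_ge_2_int[of p] by linarith
  then have p1: "1 < p" by simp
  have oddp: "odd p" using p primes_dvd_imp_eq[of 2 p] by auto
  have x1: "x1 \<noteq> 0" using s1 c by (intro notI) simp
  have "p \<le> p ^ x1" using p1 x1 by (intro self_le_power) auto
  then have c2: "2 \<le> c" using s1 p3 by linarith
  have "odd (1 + c)" unfolding s1[symmetric] using oddp by simp
  then have evc: "even c" by simp
  have big: "x1 < x" if "p ^ x = b ^ y + c" "1 \<le> y" for x y
  proof -
    have "b \<le> b ^ y" using b that by (intro self_le_power) auto
    then have "p ^ x1 < p ^ x" using b s1 that by linarith
    then show ?thesis using p1 power_less_imp_less_exp by blast
  qed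
  have x12: "x1 < x2" using big[OF s2(1)] s2(2) by simp
  have x13: "x1 < x3" using big[OF s3(1)] s3(2) by (cases y3) auto
  define X where "X = b ^ m"
  have "b \<le> X" unfolding X_def using b s2 by (intro self_le_power) auto
  then have X1: "1 < X" using b by simp
  have XX: "b ^ (2 * m) = X\<^sup>2" by (simp add: X_def power_mult mult.commute flip: power_mult)
  have "p ^ x1 dvd p ^ x2 - p ^ x1" "p ^ x1 dvd p ^ x3 - p ^ x1"
    using x12 x13 by (auto intro!: dvd_diff le_imp_power_dvd)
  then have "p ^ x1 dvd X\<^sup>2 - 1" "p ^ x1 dvd b ^ y3 - 1"
    unfolding s1 s2 s3 XX by (simp_all add: algebra_simps)
  then have c1: "[X\<^sup>2 = 1] (mod (p ^ x1))" and c3: "[b ^ y3 = 1] (mod (p ^ x1))"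
    by (simp_all add: cong_iff_dvd_diff)
  \<comment> \<open>Compute the odd power \<open>X^y3\<close> in two ways.\<close>
  obtain z where z: "y3 = 2 * z + 1" using s3(2) by (elim oddE)
  have "[(X\<^sup>2) ^ z * X = 1 ^ z * X] (mod (p ^ x1))" using c1 by (intro cong_mult cong_pow) auto
  moreover have "(X\<^sup>2) ^ z * X = X ^ y3" by (simp add: z flip: power_mult)
  moreover have "X ^ y3 = (b ^ y3) ^ m" by (simp add: X_def mult.commute flip: power_mult)
  moreover have "[(b ^ y3) ^ m = 1 ^ m] (mod (p ^ x1))" using c3 by (rule cong_pow)
  ultimately have "[X = 1] (mod (p ^ x1))" by (metis cong_sym cong_trans mult_1 power_one)
  then have dX: "p ^ x1 dvd X - 1" by (simp add: cong_iff_dvd_diff)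
  have pc: "\<not> p dvd c"
  proof
    assume "p dvd c"
    moreover have "p dvd 1 + c" unfolding s1[symmetric] using x1 by (simp add: dvd_power)
    ultimately have "p dvd 1" by (metis dvd_add_left_iff)
    then show False using p1 by simp
  qed
  interpret norm_form p 1 c 1 2 x1
    using p c2 pc x1 s1 p1 by unfold_locales auto
  have "\<not> p dvd X"
  proof
    assume "p dvd X"
    moreover have "p dvd X - 1" using dX x1 by (meson dvd_power dvd_trans not_gr_zero)
    ultimately have "p dvd 1" by (metis dvd_diff_right_iff)
    then show False using p1 by simp
  qed
  moreover have "p ^ x1 dvd 1 - X" using dX by (metis dvd_minus_iff minus_diff_eq)
  ultimately obtain j where j: "1 \<le> j" "x2 = j * x1" "elt X 1 = \<alpha> ^ j \<or> elt X 1 = - (\<alpha> ^ j)"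
    using descent[of X 1 x2] s2 XX x12 by auto
  have "j \<noteq> 1" using j(2) x12 by auto
  then have j1: "1 < j" using j(1) by simp
  define s where "s = im_pow c j"
  have root: "\<alpha> = Complex 1 (sqrt c)" and elt: "elt X 1 = Complex X (sqrt c)"
    by (simp_all add: elt_def)
  have "\<alpha> ^ j = Complex (re_pow c j) (im_pow c j * sqrt c)"
    unfolding root using c by (intro pow_parts) simp
  note pow = this
  have unit: "k = 1" if "sqrt c = real_of_int k * sqrt c" for k
    using that c by simp
  have sX: "s = 1 \<and> re_pow c j = X \<or> s = -1 \<and> re_pow c j = - X"
    using j(3)
  proof
    assume "elt X 1 = \<alpha> ^ j"
    then have "real_of_int X = real_of_int (re_pow c j)" "sqrt c = real_of_int (im_pow c j) * sqrt c"
      unfolding elt pow by simp_all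
    then have "X = re_pow c j" "im_pow c j = 1" using unit by (simp_all only: of_int_eq_iff)
    then show ?thesis by (simp add: s_def)
  next
    assume "elt X 1 = - (\<alpha> ^ j)"
    then have "real_of_int X = real_of_int (- re_pow c j)" "sqrt c = real_of_int (- im_pow c j) * sqrt c"
      unfolding elt pow by (simp_all add: complex_eq_iff)
    then have "X = - re_pow c j" "- im_pow c j = 1" using unit by (simp_all only: of_int_eq_iff)
    then show ?thesis by (simp add: s_def)
  qed
  have m8: "8 dvd re_pow c j - (1 - 3 * c) \<and> 4 dvd s - (3 - c)"
    using im_pow_unit[OF evc j1 s_def[symmetric]] sX by blast
  have oddb: "odd b"
  proof
    assume "even b"
    then have "even (p ^ x3)" unfolding s3 using evc s3(2) by (cases y3) auto
    then show False using oddp by simp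
  qed
  have "s = 1 \<and> 8 dvd X - (1 - 3 * c) \<or> s = -1 \<and> 8 dvd - X - (1 - 3 * c)"
    using m8 sX by auto
  then have X4: "X mod 4 = 3" and s4: "c mod 4 = 2 \<Longrightarrow> 8 dvd X - (1 - 3 * c)"
    using m8 evc by presburger+
  \<comment> \<open>Even powers of \<open>b\<close> are \<open>1\<close> modulo \<open>8\<close>.\<close>
  have "odd m"
  proof
    assume "even m"
    then have "X mod 8 = 1" using odd_power_mod_8[OF oddb, of m] by (simp add: X_def)
    then show False using X4 by presburger
  qed
  then have "X mod 8 = b mod 8" "b ^ y3 mod 8 = b mod 8"
    using odd_power_mod_8[OF oddb, of m] odd_power_mod_8[OF oddb, of y3] s3(2) by (simp_all add: X_def)
  then have x3: "p ^ x3 mod 8 = (X + c) mod 8" unfolding s3(1) by (intro mod_add_cong) simp_all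
  have pow_p: "p ^ x mod 8 = 1 \<or> p ^ x mod 8 = p mod 8" for x
    using odd_power_mod_8[OF oddp, of x] by (cases "odd x") simp_all
  have "c mod 4 = 2 \<or> c mod 4 = 0" using evc by presburger
  then consider "c mod 4 = 2" | "c mod 4 = 0" by blast
  then show False
  proof cases
    case 1
    then obtain k where k: "X - (1 - 3 * c) = 8 * k" using s4 by blast
    define q where "q = c div 4"
    have "c = 4 * q + 2" using 1 unfolding q_def by presburger
    then have "X + c = 5 + 8 * (k - q - 1)" using k by (simp add: algebra_simps)
    then have "(X + c) mod 8 = 5" by presburger
    then have "p mod 8 = 5" using x3 pow_p[of x3] by auto
    then have "(1 + c) mod 8 = 5 \<or> (1 + c) mod 8 = 1" using pow_p[of x1] unfolding s1 by auto
    then show False using 1 by presburger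
  next
    case 2
    have "(X + c) mod 8 \<noteq> 1" "(X + c) mod 4 = 3" using 2 X4 by presburger+
    then have "p mod 8 = (X + c) mod 8" using x3 pow_p[of x3] by simp
    then have "p mod 8 mod 4 = (X + c) mod 8 mod 4" by (rule arg_cong)
    then have "p mod 4 = 3" using \<open>(X + c) mod 4 = 3\<close> by (simp add: mod_mod_cancel)
    have "even x1"
    proof (rule ccontr)
      assume "odd x1"
      then have "(1 + c) mod 8 = p mod 8" using odd_power_mod_8[OF oddp, of x1] unfolding s1 by simp
      then have "(1 + c) mod 8 mod 4 = p mod 8 mod 4" by (rule arg_cong)
      then have "(1 + c) mod 4 = 3" using \<open>p mod 4 = 3\<close> by (simp add: mod_mod_cancel)
      then show False using 2 by presburger
    qed
    \<comment> \<open>Now \<open>c\<close> is a difference of squares \<open>Z^2 - X^2\<close>, at least \<open>2 X + 1\<close>, but \<open>X > p^x1 > c\<close>.\<close>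
    then obtain h where "x1 = 2 * h" by blast
    then have "x2 = (j * h) * 2" using j(2) by simp
    then have "p ^ x2 = (p ^ (j * h))\<^sup>2" by (simp add: power_mult)
    define Z where "Z = p ^ (j * h)"
    have Z: "Z\<^sup>2 = X\<^sup>2 + c" "0 \<le> Z"
      using \<open>p ^ x2 = (p ^ (j * h))\<^sup>2\<close> s2 XX p1 by (simp_all add: Z_def)
    then have "X\<^sup>2 < Z\<^sup>2" using c by simp
    then have "X < Z" using Z(2) by (rule power_less_imp_less_base)
    then have "(X + 1)\<^sup>2 \<le> Z\<^sup>2" using X1 by (intro power_mono) auto
    then have "2 * X + 1 \<le> c" using Z by (simp add: power2_eq_square algebra_simps)
    moreover have "p ^ x1 \<le> X - 1" using zdvd_imp_le[OF dX] X1 by simp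
    ultimately show False using s1 X1 by linarith
  qed
qed

text \<open>
  From the odd exponent, \<open>2^x1\<close> divides \<open>b - 1\<close>. Then \<open>2^(x1+1)\<close> divides \<open>b^2 - 1\<close> and so \<open>b^(2m) - 1\<close>,
  but \<open>b^(2m) - 1 = 2^x2 - 2^x1\<close> contains \<open>2\<close> exactly \<open>x1\<close> times.
\<close>
lemma no_even_and_odd_exponent_two:
  fixes b c :: int
  assumes b: "1 < b" "odd b"
    and s1: "2 ^ x1 = 1 + c" and s2: "2 ^ x2 = b ^ (2 * m) + c" "1 \<le> m"
    and s3: "2 ^ x3 = b ^ y3 + c" "odd y3"
  shows False
proof -
  have big: "x1 < x" if "2 ^ x = b ^ y + c" "1 \<le> y" for x y
  proof -
    have "b \<le> b ^ y" using b that by (intro self_le_power) auto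
    then have "(2::int) ^ x1 < 2 ^ x" using b s1 that by linarith
    then show ?thesis using power_less_imp_less_exp[of "2::int"] by simp
  qed
  have x12: "x1 < x2" using big[OF s2(1)] s2(2) by simp
  have x13: "x1 < x3" using big[OF s3(1)] s3(2) by (cases y3) auto
  have "even (b - 1)" using b(2) by simp
  then have "even (repunit b y3 - int y3)" using repunit_mod[of b y3] by (rule dvd_trans)
  then have "odd (repunit b y3)" using s3(2) by simp
  then have cop: "coprime (2 ^ x1) (repunit b y3)" by simp
  have "2 ^ x1 dvd (2::int) ^ x3 - 2 ^ x1" using x13 by (intro dvd_diff le_imp_power_dvd) auto
  moreover have "(2::int) ^ x3 - 2 ^ x1 = (b - 1) * repunit b y3" unfolding s1 s3 repunit_eq by simp
  ultimately have "2 ^ x1 dvd b - 1" using cop by (simp add: coprime_dvd_mult_left_iff)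
  moreover have "2 dvd b + 1" using b by simp
  ultimately have "2 ^ x1 * 2 dvd (b - 1) * (b + 1)" by (rule mult_dvd_mono)
  moreover have "(b - 1) * (b + 1) dvd b ^ (2 * m) - 1"
  proof -
    have "b ^ (2 * m) - 1 = (b\<^sup>2 - 1) * repunit (b\<^sup>2) m" by (simp only: power_mult repunit_eq)
    moreover have "b\<^sup>2 - 1 = (b - 1) * (b + 1)" by (simp add: algebra_simps power2_eq_square)
    ultimately show ?thesis by simp
  qed
  ultimately have "2 ^ x1 * 2 dvd b ^ (2 * m) - 1" by (rule dvd_trans)
  moreover have "b ^ (2 * m) - 1 = 2 ^ x1 * (2 ^ (x2 - x1) - 1)"
  proof -
    have "(2::int) ^ x2 = 2 ^ x1 * 2 ^ (x2 - x1)" using x12 by (simp flip: power_add)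
    then show ?thesis using s1 s2 by (simp add: algebra_simps)
  qed
  ultimately have "even ((2::int) ^ (x2 - x1) - 1)" by simp
  then show False using x12 by simp
qed

section \<open>Counting solutions\<close>

text \<open>
  If \<open>p^k\<close> is the power of \<open>p\<close> in \<open>b\<close>, then \<open>b^y < p^x\<close> gives \<open>k y < x\<close>, so \<open>c\<close> contains \<open>p\<close>
  exactly \<open>k y\<close> times.
\<close>
lemma dvd_base_exponent_unique:
  fixes p b c :: int
  assumes p: "prime p" "p dvd b" and b: "1 < b" and c: "0 < c"
    and s: "p ^ x = b ^ y + c" "p ^ x' = b ^ y' + c" and y: "1 \<le> y" "1 \<le> y'"
  shows "y = y'"
proof -
  have p1: "1 < p" using p prime_gt_1_int by blast
  define k where "k = multiplicity p b"
  obtain g where g: "b = p ^ k * g" "\<not> p dvd g"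
    unfolding k_def by (rule multiplicity_decompose'[of b p]) (use b p1 in auto)
  have k: "k \<noteq> 0" using g p by (metis mult_1 power_0)
  have "0 < g" using g b p1 by (metis zero_less_mult_pos zero_less_power less_trans zero_less_one)
  have cof: "\<exists>u. c = p ^ (k * z) * u \<and> \<not> p dvd u" if s: "p ^ w = b ^ z + c" and z: "1 \<le> z" for w z
  proof -
    have bz: "b ^ z = p ^ (k * z) * g ^ z" by (simp add: g power_mult_distrib power_mult)
    have "1 \<le> g ^ z" using \<open>0 < g\<close> by simp
    then have "p ^ (k * z) * 1 \<le> b ^ z" unfolding bz using p1 by (intro mult_left_mono) auto
    then have "p ^ (k * z) < p ^ w" using s c by simp
    then have w: "k * z < w" using p1 power_less_imp_less_exp by blast
    then have "p ^ w = p ^ (k * z) * p ^ (w - k * z)" by (simp flip: power_add)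
    then have "c = p ^ (k * z) * (p ^ (w - k * z) - g ^ z)" using s bz by (simp add: algebra_simps)
    moreover have "\<not> p dvd p ^ (w - k * z) - g ^ z"
    proof
      assume "p dvd p ^ (w - k * z) - g ^ z"
      moreover have "p dvd p ^ (w - k * z)" using w by (simp add: dvd_power)
      ultimately have "p dvd g ^ z" by (metis dvd_diff_right_iff)
      then show False using g p prime_dvd_power by blast
    qed
    ultimately show ?thesis by blast
  qed
  obtain u where u: "c = p ^ (k * y) * u" "\<not> p dvd u" using cof[OF s(1) y(1)] by blast
  obtain v where v: "c = p ^ (k * y') * v" "\<not> p dvd v" using cof[OF s(2) y(2)] by blast
  have "u * p ^ (k * y) = p ^ (k * y') * v" using u v by (simp add: mult.commute)
  then have "k * y = k * y'" using prime_power_cancel_cofactor[OF p(1) u(2) v(2)] by blast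
  then show ?thesis using k by simp
qed

text \<open>
  For \<open>c = 1\<close>, two positive exponents already force the smaller power of \<open>p\<close> to be \<open>p\<close> itself. For \<open>c > 1\<close> the cases
  not covered by the previous section are these. If the two larger exponents have the same parity, they are a pair as in \<open>same_parity_solutions\<close>, which starts at \<open>1\<close>, so the
  smallest exponent is \<open>0\<close> and \<open>c + 1\<close> is a power of \<open>p\<close>; this happens for one of the four triples only. If
  they differ in parity and the smallest is positive, it forms such a pair with one of them, and the even one violates a
  congruence modulo \<open>8\<close>.
\<close>
lemma three_solutions:
  fixes p b c :: int
  assumes p: "prime p" and b: "1 < b" and c: "0 < c" and y: "y1 < y2" "y2 < y3"
    and s: "p ^ x1 = b ^ y1 + c" "p ^ x2 = b ^ y2 + c" "p ^ x3 = b ^ y3 + c"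
  shows "(p, b, c) = (2, 5, 3)"
proof -
  have p1: "1 < p" using p prime_gt_1_int by blast
  have y23: "1 \<le> y2" "1 \<le> y3" using y by auto
  have pb: "\<not> p dvd b"
    using dvd_base_exponent_unique[OF p _ b c s(2,3) y23] y by auto
  show ?thesis
  proof (cases "c = 1")
    case True
    have "x2 = 1" using consecutive_powers[OF p b y23(1) y(2)] s True by blast
    have "b ^ y1 < b ^ y2" using b y by (intro power_strict_increasing) auto
    then have "p ^ x1 < p ^ x2" using s by simp
    then have "x1 < x2" using p1 power_less_imp_less_exp by blast
    then have "b ^ y1 + c = 1" using s(1) \<open>x2 = 1\<close> by simp
    moreover have "1 \<le> b ^ y1" using b by simp
    ultimately show ?thesis using c by simp
  next
    case False
    then have c2: "2 \<le> c" using c by simp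
    have same: "z = 1 \<and> (p, b, c) \<in> {(13, 3, 10), (2, 5, 3), (2, 3, 5), (2, 3, 13)}"
      if st: "p ^ w = b ^ z + c" "p ^ w' = b ^ z' + c" and z: "1 \<le> z" "z < z'" and par: "even z \<longleftrightarrow> even z'" for w w' z z'
    proof -
      have "even (z' - z)" using par z by simp
      then obtain d where "z' - z = 2 * d" by blast
      then have d: "z' = z + 2 * d" "1 \<le> d" using z by auto
      show ?thesis using same_parity_solutions[OF p b pb c2 z(1) d(2) st(1)] st(2) unfolding d(1) by blast
    qed
    show ?thesis
    proof (cases "y1 = 0")
      case y0: True
      show ?thesis
      proof (cases "even y2 \<longleftrightarrow> even y3")
        case True
        then have ex: "(p, b, c) \<in> {(13, 3, 10), (2, 5, 3), (2, 3, 5), (2, 3, 13)}"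
          using same[OF s(2,3) y23(1) y(2)] by blast
        have c1: "p ^ x1 = c + 1" using s(1) y0 by simp
        have "x1 \<noteq> 0" using c1 c by (intro notI) simp
        then have "p dvd c + 1" unfolding c1[symmetric] by (simp add: dvd_power)
        then have "(p, b, c) = (2, 5, 3) \<or> (p, b, c) = (2, 3, 5) \<or> (p, b, c) = (2, 3, 13)"
          using ex by auto
        moreover have "c \<noteq> 5" if "p = 2"
        proof
          assume "c = 5"
          then have x: "(2::int) ^ x1 = 6" using c1 that by simp
          have "\<not> x1 \<le> 2"
          proof
            assume "x1 \<le> 2"
            then have "x1 = 0 \<or> x1 = 1 \<or> x1 = 2" by linarith
            then show False using x by (elim disjE) simp_all
          qed
          then have "(2::int) ^ 3 dvd 2 ^ x1" by (intro le_imp_power_dvd) simp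
          then show False using x by simp
        qed
        moreover have "c \<noteq> 13" if "p = 2"
        proof
          assume "c = 13"
          then have x: "(2::int) ^ x1 = 14" using c1 that by simp
          have "\<not> x1 \<le> 2"
          proof
            assume "x1 \<le> 2"
            then have "x1 = 0 \<or> x1 = 1 \<or> x1 = 2" by linarith
            then show False using x by (elim disjE) simp_all
          qed
          then have "(2::int) ^ 3 dvd 2 ^ x1" by (intro le_imp_power_dvd) simp
          then show False using x by simp
        qed
        ultimately show ?thesis by auto
      next
        case False
        then obtain w w' z m where st: "p ^ w = b ^ (2 * m) + c" "1 \<le> m" "p ^ w' = b ^ z + c" "odd z"
        proof (cases "even y2")
          case True
          then obtain m where "y2 = 2 * m" by blast
          then show ?thesis using that[of x2 m x3 y3] s y23 False True by auto
        next
          case odd: False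
          then obtain m where "y3 = 2 * m" using False by blast
          then show ?thesis using that[of x3 m x2 y2] s y23 False odd by auto
        qed
        have s1: "p ^ x1 = 1 + c" using s(1) y0 by simp
        show ?thesis
        proof (cases "p = 2")
          case True
          have "odd b" using pb True by simp
          then show ?thesis using no_even_and_odd_exponent_two[OF b] s1 st unfolding True by blast
        next
          case False
          then show ?thesis using no_even_and_odd_exponent_odd_prime[OF p False b c s1 st] by blast
        qed
      qed
    next
      case False
      then have y1: "1 \<le> y1" by simp
      have False
      proof (cases "even y2 \<longleftrightarrow> even y3")
        case True
        then show ?thesis using same[OF s(2,3) y23(1) y(2)] y1 y by simp
      next
        case par: False
        have ex: "y1 = 1 \<and> (p, b, c) \<in> {(13, 3, 10), (2, 5, 3), (2, 3, 5), (2, 3, 13)}"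
        proof (cases "even y1 \<longleftrightarrow> even y2")
          case True
          then show ?thesis using same[OF s(1,2) y1 y(1)] by blast
        next
          case False
          then show ?thesis using same[OF s(1,3) y1] par y by auto
        qed
        have bp: "odd b" "odd p \<or> p = 2" using ex by auto
        obtain w z where wz: "p ^ w = b ^ z + c" "even z" "1 < z"
        proof (cases "even y2")
          case True
          then show ?thesis using that[of x2 y2] s(2) y y1 by simp
        next
          case False
          then have "even y3" using par by simp
          then show ?thesis using that[of x3 y3] s(3) y y1 by simp
        qed
        have bz: "b ^ z mod 8 = 1" using odd_power_mod_8[OF bp(1), of z] wz by simp
        have "b * b \<le> b ^ z"
          using wz(3) b power_increasing[of 2 z b] by (simp add: power2_eq_square)
        show ?thesis
        proof (cases "p = 2")
          case True
          have "8 < b ^ z + c" using \<open>b * b \<le> b ^ z\<close> ex by auto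
          then have "(2::int) ^ 3 < 2 ^ w" using wz True by simp
          then have "(2::int) ^ 3 dvd 2 ^ w" using power_less_imp_less_exp[of "2::int" 3 w]
            by (intro le_imp_power_dvd) simp
          then have "8 dvd b ^ z + c" using wz True by simp
          then have "(b ^ z mod 8 + c) mod 8 = 0" by (simp add: mod_add_left_eq)
          then have "(1 + c) mod 8 = 0" unfolding bz .
          then show ?thesis using ex True by auto
        next
          case False
          then have p13: "p = 13" "c = 10" using ex by auto
          have "p ^ w mod 8 = (b ^ z mod 8 + c) mod 8" unfolding wz(1) by (simp add: mod_add_left_eq)
          then have "(13::int) ^ w mod 8 = 3" unfolding bz p13 by simp
          then show ?thesis using odd_power_mod_8[of 13 w] by (simp split: if_splits)
        qed
      qed
      then show ?thesis by blast
    qed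
  qed
qed

lemma solutions_le_2:
  fixes a b c :: int
  assumes a: "prime a" and b: "1 < b" and c: "0 < c" and ne: "(a, b, c) \<noteq> (2, 5, 3)"
  shows "finite (solutions a b c) \<and> card (solutions a b c) \<le> 2"
proof (rule ccontr)
  assume "\<not> (finite (solutions a b c) \<and> card (solutions a b c) \<le> 2)"
  then have "\<exists>T \<subseteq> solutions a b c. card T = 3"
    by (metis Suc_leI infinite_arbitrarily_large not_le numeral_2_eq_2 numeral_3_eq_3 obtain_subset_with_card_n)
  then obtain u v w where T: "{u, v, w} \<subseteq> solutions a b c" "u \<noteq> v" "u \<noteq> w" "v \<noteq> w"
    by (auto simp: card_3_iff)
  have a1: "1 < a" using a prime_gt_1_int by blast
  have snd: "snd r \<noteq> snd s" if "r \<in> solutions a b c" "s \<in> solutions a b c" "r \<noteq> s" for r s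
  proof
    assume eq: "snd r = snd s"
    then have "a ^ fst r = a ^ fst s" using that by (auto simp: solutions_def)
    then have "fst r = fst s" using a1 power_inject_exp by blast
    then show False using eq that(3) by (simp add: prod_eq_iff)
  qed
  have no: False if "r \<in> solutions a b c" "s \<in> solutions a b c" "t \<in> solutions a b c"
    "snd r < snd s" "snd s < snd t" for r s t
  proof -
    have "a ^ fst x = b ^ snd x + c" if "x \<in> solutions a b c" for x
      using that by (auto simp: solutions_def)
    then show False using three_solutions[OF a b c that(4,5), of "fst r" "fst s" "fst t"] that(1,2,3) ne by blast
  qed
  have mem: "u \<in> solutions a b c" "v \<in> solutions a b c" "w \<in> solutions a b c" using T by auto
  have "snd u \<noteq> snd v" "snd u \<noteq> snd w" "snd v \<noteq> snd w" using snd mem T by auto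
  then consider "snd u < snd v" "snd v < snd w" | "snd u < snd w" "snd w < snd v"
    | "snd v < snd u" "snd u < snd w" | "snd v < snd w" "snd w < snd u"
    | "snd w < snd u" "snd u < snd v" | "snd w < snd v" "snd v < snd u"
    by linarith
  then show False using no mem by cases blast+
qed

lemma solutions_2_5_3: "solutions 2 5 3 = {(2, 0), (3, 1), (7, 3)}"
proof
  show "{(2, 0), (3, 1), (7, 3)} \<subseteq> solutions 2 5 3" by (simp add: solutions_def)
  show "solutions 2 5 3 \<subseteq> {(2, 0), (3, 1), (7, 3)}"
  proof
    fix s assume "s \<in> solutions 2 5 3"
    then obtain x y where s: "s = (x, y)" and eq: "(2::int) ^ x = 5 ^ y + 3"
      by (auto simp: solutions_def)
    have xI: "x = n" if "(2::int) ^ x = 2 ^ n" for n using that by simp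
    have m: "(5::int) ^ y mod 8 = (if odd y then 5 else 1)" using odd_power_mod_8[of 5 y] by simp
    have "even y \<or> y = 1 \<or> y = 3 \<or> odd y \<and> 5 \<le> y" by presburger
    then consider "even y" | "y = 1" | "y = 3" | "odd y" "5 \<le> y" by blast
    then show "s \<in> {(2, 0), (3, 1), (7, 3)}"
    proof cases
      case 1
      have "\<not> 3 \<le> x"
      proof
        assume "3 \<le> x"
        then have "(2::int) ^ 3 dvd 2 ^ x" by (rule le_imp_power_dvd)
        then have "8 dvd (5::int) ^ y + 3" unfolding eq by simp
        then show False using m 1 by presburger
      qed
      then have "x = 0 \<or> x = 1 \<or> x = 2" by linarith
      moreover have "(1::int) \<le> 5 ^ y" by simp
      then have "(2::int) ^ x \<noteq> 2 ^ 0" "(2::int) ^ x \<noteq> 2 ^ 1" unfolding eq power_0 power_one_right by linarith+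
      ultimately have "x = 2" by auto
      moreover have "(5::int) ^ y = 1" using eq unfolding \<open>x = 2\<close> by simp
      ultimately have "x = 2 \<and> (5::int) ^ y = 1" by blast
      then show ?thesis using s by simp
    next
      case 2
      then show ?thesis using s eq xI[of 3] by simp
    next
      case 3
      then show ?thesis using s eq xI[of 7] by simp
    next
      case 4
      then have "even (y - 3)" "3 \<le> y" by auto
      then obtain d where "y - 3 = 2 * d" by blast
      then have d: "y = 3 + 2 * d" "1 \<le> d" using 4 by auto
      have "prime (2::int)" by simp
      then have "(3::nat) = 1"
        using same_parity_solutions[of 2 5 3 3 d 7 x] d(2) eq unfolding d(1) by simp
      then show ?thesis by simp
    qed
  qed
qed

text \<open>
  The witnesses are \<open>b = 2^s - 1\<close>, \<open>c = 2^(s+1) - 1\<close> for \<open>s \<ge> 2\<close>; the two solutions are \<open>(s + 1, 0)\<close> and \<open>(2 s, 2)\<close>.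
\<close>
lemma infinite_two_solutions:
  "infinite {(a :: int, b :: int, c :: int). prime a \<and> b > 1 \<and> c > 0 \<and> card (solutions a b c) = 2}"
proof -
  define f :: "nat \<Rightarrow> int \<times> int \<times> int" where "f t = (2, 2 ^ (t + 2) - 1, 2 ^ (t + 3) - 1)" for t
  have "inj f" by (rule injI) (simp add: f_def)
  then have "infinite (range f)" using finite_imageD by blast
  moreover have "range f \<subseteq> {(a, b, c). prime a \<and> b > 1 \<and> c > 0 \<and> card (solutions a b c) = 2}"
  proof
    fix s assume "s \<in> range f"
    then obtain t where s: "s = f t" by blast
    define b c :: int where "b = 2 ^ (t + 2) - 1" and "c = 2 ^ (t + 3) - 1"
    have "(1::int) \<le> 2 ^ t" by simp
    moreover have "b = 4 * 2 ^ t - 1" "c = 8 * 2 ^ t - 1" by (simp_all add: b_def c_def power_add)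
    ultimately have bc: "1 < b" "0 < c" by linarith+
    have "4 dvd b + 1" by (simp add: b_def power_add)
    then have "b \<noteq> 5" by auto
    then have le: "finite (solutions 2 b c) \<and> card (solutions 2 b c) \<le> 2"
      using solutions_le_2[of 2 b c] bc by simp
    have "{(t + 3, 0), (2 * t + 4, 2)} \<subseteq> solutions 2 b c"
      by (simp add: solutions_def b_def c_def power_add power_mult power2_eq_square algebra_simps)
    then have "card {(t + 3, 0 :: nat), (2 * t + 4, 2)} \<le> card (solutions 2 b c)"
      using le by (intro card_mono) auto
    then have "card (solutions 2 b c) = 2" using le by simp
    then show "s \<in> {(a, b, c). prime a \<and> b > 1 \<and> c > 0 \<and> card (solutions a b c) = 2}"
      using bc by (simp add: s f_def b_def c_def)
  qed
  ultimately show ?thesis using infinite_super by blast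
qed

theorem theorem1:
  shows "(\<forall>a b c :: int. prime a \<and> b > 1 \<and> c > 0 \<and> (a, b, c) \<noteq> (2, 5, 3) \<longrightarrow>
            finite (solutions a b c) \<and> card (solutions a b c) \<le> 2)
       \<and> solutions 2 5 3 = {(2, 0), (3, 1), (7, 3)}
       \<and> infinite {(a :: int, b :: int, c :: int).
            prime a \<and> b > 1 \<and> c > 0 \<and> card (solutions a b c) = 2}"
  using solutions_le_2 solutions_2_5_3 infinite_two_solutions by blast

end
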